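(* Suppose that $1<a\leq b<a^2$ and that $\delta$ is a nonnegative number, and set $\tau:=\log_a b$. If $(X,d,\mu)$ belongs to the class $\mathcal{X}_{a,b}^{\delta}$, then the centred Hardy--Littlewood maximal operator $\mathcal{M}$ on $X$ is bounded on $L^p(X)$ for all $p>\tau$, and it is of weak type $(\tau,\tau)$.
   Context: Balls: in a metric space $(X,d)$, $B_r(x):=\{y\in X: d(x,y)<r\}$ is the open ball with centre $x$ and radius $r$. Maximal operator: for a locally integrable function $f$ on a metric measure space $(X,d,\mu)$ all of whose balls have positive finite measure, $$\mathcal{M}f(x):=\sup_{r>0}\frac{1}{\mu(B_r(x))}\int_{B_r(x)}|f|\,d\mu .$$ Weak type $(p,p)$ means that there is a constant $C$ such that $\mu(\{\mathcal{M}f>\lambda\})\le C\lambda^{-p}\|f\|_{L^p(X)}^p$ for all $\lambda>0$ and $f\in L^p(X)$. $\delta$-hyperbolicity: the Gromov product is $(y,z)_x:=\frac12\big(d(x,y)+d(x,z)-d(y,z)\big)$. A metric space $(X,d)$ is $\delta$-hyperbolic if $(x,z)_w\ge\min\big((x,y)_w,(y,z)_w\big)-\delta$ for all $x,y,z,w\in X$. Length space: $(X,d)$ is here a length space with strictly intrinsic metric $d$, i.e. for every $x,y \in X$ the distance $d(x,y)$ is the minimum of the lengths of the paths joining $x$ and $y$; in particular any two points are connected by a shortest path. Locally doubling: a Borel measure $\mu$ on $(X,d)$ is locally doubling if for every $s>0$ there is a constant $L_s$ such that $\mu(B_{2r}(x))\le L_s\,\mu(B_r(x))$ for all $x\in X$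 and all $0<r\le s$. $(a,b)$-pinched exponential growth at infinity: there exist positive constants $c$ and $C$ such that $c\,a^r\le\mu(B_r(x))\le C\,b^r$ for all $x\in X$ and all $r\in[1,\infty)$. The class $\mathcal{X}_{a,b}^{\delta}$ (for $\delta\ge0$, $1<a\le b$) consists of all connected noncompact complete $\delta$-hyperbolic length spaces $(X,d)$ (with $d$ strictly intrinsic), endowed with a locally doubling Borel measure $\mu$ with $(a,b)$-pinched exponential growth at infinity. (These conditions imply $0<\mu(B)<\infty$ for every ball $B$.) *)

theory Defs
  imports "HOL-Analysis.Analysis" "HOL-Probability.Essential_Supremum"
begin

definition Gromov_product :: "'a::metric_space \<Rightarrow> 'a \<Rightarrow> 'a \<Rightarrow> real" where
  "Gromov_product x y z = (dist x y + dist x z - dist y z) / 2"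

text \<open>The base point is the first argument of \<open>Gromov_product\<close>: the product
  of \<open>y\<close> and \<open>z\<close> at \<open>x\<close> is \<open>Gromov_product x y z\<close>.\<close>

definition Gromov_hyperbolic :: "real \<Rightarrow> 'a::metric_space set \<Rightarrow> bool" where
  "Gromov_hyperbolic \<delta> S \<longleftrightarrow>
     (\<forall>x\<in>S. \<forall>y\<in>S. \<forall>z\<in>S. \<forall>w\<in>S.
        Gromov_product w x z \<ge> min (Gromov_product w x y) (Gromov_product w y z) - \<delta>)"

definition path_length :: "(real \<Rightarrow> 'a::metric_space) \<Rightarrow> ennreal" where
  "path_length g =
     (SUP (n, t) \<in> {(n::nat, t::nat \<Rightarrow> real). mono_on {..n} t \<and> t ` {..n} \<subseteq> {0..1}}.
        \<Sum>i<n. ennreal (dist (g (t i)) (g (t (Suc i)))))"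

definition strictly_intrinsic :: "'a::metric_space set \<Rightarrow> bool" where
  "strictly_intrinsic S \<longleftrightarrow>
     (\<forall>x\<in>S. \<forall>y\<in>S.
        let L = {path_length g |g. path g \<and> path_image g \<subseteq> S \<and> pathstart g = x \<and> pathfinish g = y}
        in ennreal (dist x y) \<in> L \<and> (\<forall>l\<in>L. ennreal (dist x y) \<le> l))"

definition locally_doubling :: "'a::metric_space measure \<Rightarrow> bool" where
  "locally_doubling \<mu> \<longleftrightarrow>
     (\<forall>s>0. \<exists>L::real. \<forall>x r. 0 < r \<and> r \<le> s \<longrightarrow>
        emeasure \<mu> (ball x (2 * r)) \<le> ennreal L * emeasure \<mu> (ball x r))"

definition pinched_exponential_growth :: "real \<Rightarrow> real \<Rightarrow> 'a::metric_space measure \<Rightarrow> bool" where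
  "pinched_exponential_growth a b \<mu> \<longleftrightarrow>
     (\<exists>c C::real. c > 0 \<and> C > 0 \<and>
        (\<forall>x. \<forall>r\<ge>1. ennreal (c * a powr r) \<le> emeasure \<mu> (ball x r) \<and>
                     emeasure \<mu> (ball x r) \<le> ennreal (C * b powr r)))"

text \<open>The metric space is the whole type \<open>'a\<close>, so that a member of the class is
  determined by its measure. Completeness and noncompactness are those of \<open>UNIV\<close>.\<close>

definition class_X :: "real \<Rightarrow> real \<Rightarrow> real \<Rightarrow> 'a::metric_space measure set" where
  "class_X \<delta> a b =
     {\<mu>. connected (UNIV :: 'a set) \<and> \<not> compact (UNIV :: 'a set) \<and> complete (UNIV :: 'a set) \<and>
         Gromov_hyperbolic \<delta> (UNIV :: 'a set) \<and> strictly_intrinsic (UNIV :: 'a set) \<and>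
         sets \<mu> = sets borel \<and> locally_doubling \<mu> \<and> pinched_exponential_growth a b \<mu>}"

text \<open>The power of an extended nonnegative real, for an exponent \<open>r > 0\<close>.\<close>

definition ennreal_powr :: "ennreal \<Rightarrow> real \<Rightarrow> ennreal" where
  "ennreal_powr x r = (if x = top then top else ennreal (enn2real x powr r))"

text \<open>The norm is defined for functions with values in \<open>[0,\<infinity>]\<close>, since maximal
  functions may take the value \<open>\<infinity>\<close>; real functions enter through their absolute
  value. The exponent ranges over \<open>(0,\<infinity>]\<close>.\<close>

definition Lp_norm :: "'a measure \<Rightarrow> ennreal \<Rightarrow> ('a \<Rightarrow> ennreal) \<Rightarrow> ennreal" where
  "Lp_norm \<mu> p g =
     (if p = top then esssup \<mu> g
      else ennreal_powr (\<integral>\<^sup>+x. ennreal_powr (g x) (enn2real p) \<partial>\<mu>) (1 / enn2real p))"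

definition Lp_space :: "'a measure \<Rightarrow> ennreal \<Rightarrow> ('a \<Rightarrow> real) set" where
  "Lp_space \<mu> p = {f \<in> borel_measurable \<mu>. Lp_norm \<mu> p (\<lambda>x. ennreal \<bar>f x\<bar>) < top}"

definition maximal_function :: "'a::metric_space measure \<Rightarrow> ('a \<Rightarrow> real) \<Rightarrow> 'a \<Rightarrow> ennreal" where
  "maximal_function \<mu> f x =
     (SUP r\<in>{0<..}. (\<integral>\<^sup>+y\<in>ball x r. ennreal \<bar>f y\<bar> \<partial>\<mu>) / emeasure \<mu> (ball x r))"

text \<open>Measurability of \<open>T f\<close> is part of both notions below: a nonmeasurable set has
  \<open>emeasure\<close> zero, and the nonnegative integral of a nonmeasurable function is
  only a lower integral.\<close>

definition bounded_on_Lp ::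
  "'a measure \<Rightarrow> ennreal \<Rightarrow> (('a \<Rightarrow> real) \<Rightarrow> 'a \<Rightarrow> ennreal) \<Rightarrow> bool" where
  "bounded_on_Lp \<mu> p T \<longleftrightarrow>
     (\<exists>C::real. \<forall>f \<in> Lp_space \<mu> p. T f \<in> borel_measurable \<mu> \<and>
        Lp_norm \<mu> p (T f) \<le> ennreal C * Lp_norm \<mu> p (\<lambda>x. ennreal \<bar>f x\<bar>))"

definition weak_type ::
  "'a measure \<Rightarrow> real \<Rightarrow> (('a \<Rightarrow> real) \<Rightarrow> 'a \<Rightarrow> ennreal) \<Rightarrow> bool" where
  "weak_type \<mu> p T \<longleftrightarrow>
     (\<exists>C::real. \<forall>f \<in> Lp_space \<mu> (ennreal p). T f \<in> borel_measurable \<mu> \<and>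
        (\<forall>t::real. t > 0 \<longrightarrow>
           emeasure \<mu> {x \<in> space \<mu>. T f x > ennreal t}
             \<le> ennreal (C * t powr (- p)) *
                ennreal_powr (Lp_norm \<mu> (ennreal p) (\<lambda>x. ennreal \<bar>f x\<bar>)) p))"

end

theory Submission
  imports Defs
begin

text \<open>For \<open>p = \<infinity>\<close> an average of \<open>|f|\<close> is at most its essential supremum. All else
  follows from one distributional inequality: there is \<open>K\<close> with
  \<open>\<mu> {Mf > t} \<le> K t\<^sup>-\<^sup>\<tau> \<integral> |f|\<^sup>\<tau> 1{|f| > t / 2} d\<mu>\<close> for all \<open>t > 0\<close>
  (\<open>maximal_function_superlevel_estimate\<close>). The weak type bound is immediate, and
  for \<open>\<tau> < p < \<infinity>\<close> one sums the inequality over \<open>t = 2\<^sup>k\<close>, \<open>k\<close> an integer.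

  To prove it, let \<open>g = 2 |f| / t\<close> where \<open>|f| > t / 2\<close> and \<open>g = 0\<close> elsewhere. If an average of
  \<open>|f|\<close> over a ball exceeds \<open>t\<close>, then the average of \<open>g\<close> over this ball exceeds 1. Balls of radius
  at most 1 are handled by Vitali covering and local doubling, with bound \<open>L\<^sup>2 \<integral> g\<close>
  (\<open>local_covering_estimate\<close>). A larger ball gives an integer \<open>n \<ge> 1\<close> for which the integral of
  \<open>g\<close> over the ball of radius \<open>n\<close> exceeds a multiple of \<open>a\<^sup>n\<close>.

  The geometry enters as follows. Fix a base point \<open>p\<close>. The points \<open>x\<close> of the ball of centre \<open>y\<close>
  and radius \<open>n\<close> with \<open>d(x, p) \<le> d(y, p) + s\<close> form a ``half ball'', which by hyperbolicity lies
  in a ball of radius \<open>(n + s) / 2 + 2 \<delta> + 1\<close> (\<open>hyperbolic_half_ball_subset_ball\<close>) and so has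
  measure at most a multiple of \<open>b\<close> to the power \<open>(n + s) / 2\<close>. Splitting the pairs \<open>(x, y)\<close> with
  \<open>d(x, y) < n\<close> into \<open>d(x, p) \<le> d(y, p) + s\<close> and its complement, each half is estimated by
  fixing the variable for which its slices are half balls. With the right \<open>s\<close>, this shows that if
  \<open>u\<close> has mass at most \<open>m\<close> on each unit ball centred in its support, then the integral of \<open>u\<close>
  over the ball of centre \<open>x\<close> and radius \<open>n\<close> exceeds \<open>\<theta>\<close> only on a set of measure at most
  \<open>K b\<^sup>n m \<theta>\<^sup>-\<^sup>2 \<integral> u\<close> (\<open>ball_integral_weak_type_if_unit_balls_light\<close>).

  This is applied to the parts \<open>u\<^sub>k\<close> of \<open>g\<close> on which the mass of the unit ball is comparable with
  \<open>a\<^sup>k\<close> (for \<open>k = 0\<close>, merely less than \<open>a\<close>), with \<open>k < n\<close> and \<open>\<theta>\<close> comparable with \<open>a\<^sup>n q\<^sup>n\<^sup>-\<^sup>k\<close>, where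
  \<open>q < 1\<close> is so close to 1 that \<open>\<rho> = b / (a q)\<^sup>2\<close> is still less than 1; this is where \<open>b < a\<^sup>2\<close> is needed.
  The bound is then a multiple of \<open>\<rho>\<^sup>n\<^sup>-\<^sup>k (b / a)\<^sup>k \<integral> u\<^sub>k\<close>, which can be summed over \<open>n > k\<close>, and
  \<open>b = a\<^sup>\<tau>\<close> turns the sum over \<open>k\<close> into \<open>\<integral> g\<^sup>\<tau>\<close> (\<open>sum_level_parts\<close>). If instead the ball of radius \<open>n\<close>
  contains the centre of a unit ball of mass at least \<open>a\<^sup>n\<close>, the crude bound \<open>b\<^sup>n\<close> for the measure of
  balls suffices, because \<open>b\<^sup>n = (a\<^sup>n)\<^sup>\<tau>\<close> (\<open>sum_neighbourhoods_of_heavy_points\<close>). Using the mass of unit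
  balls instead of the values of \<open>g\<close> in the decomposition makes the endpoint exponent reachable even for
  \<open>a = b\<close>, where \<open>\<tau> = 1\<close>.\<close>

section \<open>Integrals over balls in metric measure spaces\<close>

text \<open>Fatou's lemma, since \<open>indicator (ball x r)\<close> is pointwise lower semicontinuous in \<open>x\<close>.\<close>

lemma ball_integral_lower_semicontinuous:
  fixes M :: "'a::metric_space measure"
  assumes [measurable_cong]: "sets M = sets borel" and [measurable]: "g \<in> borel_measurable M"
  shows "open {x. t < (\<integral>\<^sup>+y\<in>ball x r. g y \<partial>M)}"
proof -
  have "closed {x. (\<integral>\<^sup>+y\<in>ball x r. g y \<partial>M) \<le> t}"
    unfolding closed_sequential_limits
  proof safe
    fix X x assume X: "\<forall>n. X n \<in> {x. (\<integral>\<^sup>+y\<in>ball x r. g y \<partial>M) \<le> t}" and lim: "X \<longlonglongrightarrow> x"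
    have "g y * indicator (ball x r) y \<le> liminf (\<lambda>n. g y * indicator (ball (X n) r) y)" for y
    proof (cases "y \<in> ball x r")
      case True
      have "(\<lambda>n. dist (X n) y) \<longlonglongrightarrow> dist x y" by (intro tendsto_intros lim)
      then have "eventually (\<lambda>n. dist (X n) y < r) sequentially"
        using True by (auto intro: order_tendstoD(2))
      then show ?thesis
        using True by (intro Liminf_bounded) (auto elim!: eventually_mono)
    qed simp
    then have "(\<integral>\<^sup>+y\<in>ball x r. g y \<partial>M) \<le> (\<integral>\<^sup>+y. liminf (\<lambda>n. g y * indicator (ball (X n) r) y) \<partial>M)"
      by (intro nn_integral_mono)
    also have "\<dots> \<le> liminf (\<lambda>n. \<integral>\<^sup>+y\<in>ball (X n) r. g y \<partial>M)"
      by (intro nn_integral_liminf borel_measurable_times_ennreal borel_measurable_indicator) (auto simp: assms)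
    also have "\<dots> \<le> liminf (\<lambda>n. t)"
      using X by (intro Liminf_mono) auto
    also have "\<dots> = t" by (simp add: Liminf_const)
    finally show "(\<integral>\<^sup>+y\<in>ball x r. g y \<partial>M) \<le> t" .
  qed
  moreover have "{x. t < (\<integral>\<^sup>+y\<in>ball x r. g y \<partial>M)} = - {x. (\<integral>\<^sup>+y\<in>ball x r. g y \<partial>M) \<le> t}"
    by auto
  ultimately show ?thesis by (simp add: open_Compl)
qed

lemma borel_measurable_ball_integral:
  fixes M :: "'a::metric_space measure"
  assumes M: "sets M = sets borel" and g: "g \<in> borel_measurable M"
  shows "(\<lambda>x. \<integral>\<^sup>+y\<in>ball x r. g y \<partial>M) \<in> borel_measurable M"
proof (rule borel_measurableI_greater)
  fix t
  have "space M = UNIV" using sets_eq_imp_space_eq[OF M] by simp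
  then show "{x \<in> space M. t < (\<integral>\<^sup>+y\<in>ball x r. g y \<partial>M)} \<in> sets M"
    using ball_integral_lower_semicontinuous[OF M g, of t r] by (simp add: M)
qed

lemma inverse_antimono_ennreal: "a \<le> b \<Longrightarrow> inverse b \<le> inverse (a::ennreal)"
  by (simp add: less_eq_ennreal.rep_eq inverse_ennreal.rep_eq ereal_inverse_antimono)

text \<open>Open balls are increasing unions of smaller ones, so a radius \<open>r\<close> is approximated from below;
  replacing \<open>r\<close> by a smaller rational radius in the denominator only enlarges the quotient.\<close>

lemma maximal_function_eq_SUP_rational:
  fixes M :: "'a::metric_space measure"
  assumes M[measurable_cong]: "sets M = sets borel" and [measurable]: "f \<in> borel_measurable M"
  shows "maximal_function M f x =
    (SUP r\<in>\<rat> \<inter> {0<..}. (\<integral>\<^sup>+y\<in>ball x r. ennreal \<bar>f y\<bar> \<partial>M) / emeasure M (ball x r))"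
    (is "_ = ?R")
proof (rule antisym)
  have [measurable]: "ball z r \<in> sets M" for z r by (simp add: M)
  define I where "I r = (\<integral>\<^sup>+y\<in>ball x r. ennreal \<bar>f y\<bar> \<partial>M)" for r
  have I_mono: "I r \<le> I s" if "r \<le> s" for r s
    unfolding I_def using that by (intro nn_integral_mono) (auto split: split_indicator)
  have "I r / emeasure M (ball x r) \<le> ?R" if r: "r > 0" for r
  proof -
    define \<rho> where "\<rho> n = r - r / (real n + 2)" for n
    have lim: "\<rho> \<longlonglongrightarrow> r"
      unfolding \<rho>_def by real_asymp
    have \<rho>: "0 < \<rho> n" "\<rho> n < r" for n
      using r by (auto simp: \<rho>_def field_simps add_pos_nonneg)
    have "mono \<rho>"
      using r by (auto simp: mono_def \<rho>_def intro!: divide_left_mono)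
    then have inc: "incseq (\<lambda>n y. ennreal \<bar>f y\<bar> * indicator (ball x (\<rho> n)) y)"
      by (fastforce simp: mono_def le_fun_def split: split_indicator)
    have "(SUP n. ennreal \<bar>f y\<bar> * indicator (ball x (\<rho> n)) y) = ennreal \<bar>f y\<bar> * indicator (ball x r) y" for y
    proof (cases "dist x y < r")
      case True
      obtain n where "dist x y < \<rho> n"
        using order_tendstoD(1)[OF lim True] by (auto simp: eventually_sequentially)
      then show ?thesis using True
        by (intro antisym SUP_least SUP_upper2[of n]) (auto split: split_indicator)
    next
      case False
      then have "\<not> dist x y < \<rho> n" for n using \<rho>(2)[of n] by simp
      then show ?thesis using False by simp
    qed
    then have "I r = (SUP n. I (\<rho> n))"
      unfolding I_def by (subst nn_integral_monotone_convergence_SUP[OF inc, symmetric]) auto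
    then have "I r / emeasure M (ball x r) = (SUP n. I (\<rho> n) / emeasure M (ball x r))"
      by (simp add: divide_ennreal_def SUP_mult_right_ennreal)
    also have "\<dots> \<le> ?R"
    proof (rule SUP_least)
      fix n
      obtain q where q: "q \<in> \<rat>" "\<rho> n < q" "q < r" using Rats_dense_in_real[OF \<rho>(2)] by blast
      have "emeasure M (ball x q) \<le> emeasure M (ball x r)"
        using q by (intro emeasure_mono) auto
      then have "I (\<rho> n) / emeasure M (ball x r) \<le> I q / emeasure M (ball x q)"
        unfolding divide_ennreal_def using q
        by (intro mult_mono I_mono inverse_antimono_ennreal) auto
      also have "\<dots> \<le> ?R"
        unfolding I_def using q \<rho>(1)[of n] by (intro SUP_upper) auto
      finally show "I (\<rho> n) / emeasure M (ball x r) \<le> ?R" .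
    qed
    finally show ?thesis .
  qed
  then show "maximal_function M f x \<le> ?R"
    unfolding maximal_function_def I_def by (intro SUP_least) auto
qed (auto simp: maximal_function_def intro!: SUP_subset_mono)

lemma borel_measurable_maximal_function:
  fixes M :: "'a::metric_space measure"
  assumes M[measurable_cong]: "sets M = sets borel" and [measurable]: "f \<in> borel_measurable M"
  shows "maximal_function M f \<in> borel_measurable M"
proof -
  have [measurable]: "(\<lambda>x. \<integral>\<^sup>+y\<in>ball x r. ennreal \<bar>f y\<bar> \<partial>M) \<in> borel_measurable M" for r
    by (rule borel_measurable_ball_integral[OF M]) measurable
  have "(\<lambda>x. \<integral>\<^sup>+y\<in>ball x r. 1 \<partial>M) \<in> borel_measurable M" for r
    by (rule borel_measurable_ball_integral[OF M]) measurable
  then have [measurable]: "(\<lambda>x. emeasure M (ball x r)) \<in> borel_measurable M" for r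
    by (simp add: M)
  have "countable (\<rat> \<inter> {0<..} :: real set)" by (simp add: countable_rat)
  moreover have "maximal_function M f = (\<lambda>x. SUP r\<in>\<rat> \<inter> {0<..}.
      (\<integral>\<^sup>+y\<in>ball x r. ennreal \<bar>f y\<bar> \<partial>M) / emeasure M (ball x r))"
    using maximal_function_eq_SUP_rational[OF M, of f] by auto
  ultimately show ?thesis by simp
qed

text \<open>Balls of positive finite measure force separability: in a maximal
  \<open>e\<close>-separated set, the disjoint balls of radius \<open>e/2\<close> inside a fixed large ball, each of
  measure more than \<open>1/m\<close>, are finite in number.\<close>

lemma countable_dense_if_balls_pos_finite:
  fixes M :: "'a::metric_space measure"
  assumes M[measurable_cong]: "sets M = sets borel"
    and pos: "\<And>x r. r > 0 \<Longrightarrow> 0 < emeasure M (ball x r)"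
    and fin: "\<And>x r. emeasure M (ball x r) < \<infinity>"
  obtains D :: "'a set" where "countable D" "\<And>x e. e > 0 \<Longrightarrow> \<exists>d\<in>D. dist d x < e"
proof -
  define sep where "sep e S \<longleftrightarrow> (\<forall>x\<in>S. \<forall>y\<in>S. x \<noteq> y \<longrightarrow> e \<le> dist x y)" for e and S :: "'a set"
  have ctble: "countable S" if S: "sep e S" and e: "e > 0" for e S
  proof (cases "S = {}")
    case False
    then obtain o' where "o' \<in> S" by auto
    define T where "T n m = {s\<in>S. dist o' s < real n \<and> 1 / real (Suc m) < measure M (ball s (e/2))}" for n m
    have "finite (T n m)" for n m
    proof -
      define B where "B = measure M (ball o' (n + e))"
      have "card F \<le> nat \<lfloor>B * Suc m\<rfloor>" if F: "F \<subseteq> T n m" "finite F" for F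
      proof -
        have disj: "disjoint_family_on (\<lambda>s. ball s (e/2)) F"
          unfolding disjoint_family_on_def
        proof (intro ballI impI)
          fix x y assume "x \<in> F" "y \<in> F" "x \<noteq> y"
          then have "e \<le> dist x y" using S F by (auto simp: sep_def T_def)
          then show "ball x (e/2) \<inter> ball y (e/2) = {}" using disjoint_ballI by (metis field_sum_of_halves)
        qed
        have "card F * (1 / Suc m) = (\<Sum>s\<in>F. 1 / Suc m)" by simp
        also have "\<dots> \<le> (\<Sum>s\<in>F. measure M (ball s (e/2)))"
          using F by (intro sum_mono) (auto simp: T_def)
        also have "\<dots> = measure M (\<Union>s\<in>F. ball s (e/2))"
          using fin by (intro measure_finite_Union[symmetric] F disj) (auto simp: M top.not_eq_extremum)
        also have "\<dots> \<le> B"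
          unfolding B_def
        proof (rule measure_mono_fmeasurable)
          show "(\<Union>s\<in>F. ball s (e/2)) \<subseteq> ball o' (n + e)"
          proof safe
            fix s y assume "s \<in> F" "y \<in> ball s (e/2)"
            moreover have "dist o' y \<le> dist o' s + dist s y" by (rule dist_triangle)
            ultimately show "y \<in> ball o' (n + e)" using F e by (auto simp: T_def)
          qed
          show "ball o' (real n + e) \<in> fmeasurable M" using fin by (intro fmeasurableI) (auto simp: M)
          show "(\<Union>s\<in>F. ball s (e/2)) \<in> sets M" unfolding M by (intro borel_open) auto
        qed
        finally have "card F \<le> B * Suc m" by (simp add: field_simps)
        then show ?thesis by linarith
      qed
      then show ?thesis using finite_if_finite_subsets_card_bdd by blast
    qed
    moreover have "S \<subseteq> (\<Union>n m. T n m)"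
    proof
      fix s assume s: "s \<in> S"
      have "0 < measure M (ball s (e/2))"
        using pos[of "e/2" s] fin[of s "e/2"] e by (simp add: emeasure_eq_ennreal_measure top.not_eq_extremum)
      then obtain m where "1 / real (Suc m) < measure M (ball s (e/2))"
        using nat_approx_posE by auto
      moreover obtain n where "dist o' s < real n" using reals_Archimedean2 by auto
      ultimately show "s \<in> (\<Union>n m. T n m)" using s by (auto simp: T_def)
    qed
    ultimately show ?thesis
      by (meson countable_UN countable_finite countable_subset countableI_type)
  qed simp
  have "\<exists>S. sep e S \<and> (\<forall>x. \<exists>s\<in>S. dist s x < e)" if e: "e > 0" for e
  proof -
    have "\<exists>S\<in>Collect (sep e). \<forall>X\<in>Collect (sep e). S \<subseteq> X \<longrightarrow> X = S"
    proof (rule subset_Zorn')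
      fix \<C> assume "subset.chain (Collect (sep e)) \<C>"
      then have C: "\<C> \<subseteq> Collect (sep e)" "\<And>X Y. X \<in> \<C> \<Longrightarrow> Y \<in> \<C> \<Longrightarrow> X \<subseteq> Y \<or> Y \<subseteq> X"
        by (auto simp: subset_chain_def)
      show "\<Union>\<C> \<in> Collect (sep e)"
        unfolding sep_def mem_Collect_eq
      proof (intro ballI impI)
        fix x y assume "x \<in> \<Union>\<C>" "y \<in> \<Union>\<C>" "x \<noteq> y"
        then obtain X Y where XY: "X \<in> \<C>" "Y \<in> \<C>" "x \<in> X" "y \<in> Y" by auto
        then obtain Z where "Z \<in> \<C>" "x \<in> Z" "y \<in> Z" using C(2) by blast
        then show "e \<le> dist x y" using C(1) \<open>x \<noteq> y\<close> by (auto simp: sep_def)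
      qed
    qed
    then obtain S where S: "sep e S" and max: "\<And>X. sep e X \<Longrightarrow> S \<subseteq> X \<Longrightarrow> X = S" by auto
    have "\<exists>s\<in>S. dist s x < e" for x
    proof (rule ccontr)
      assume *: "\<not> (\<exists>s\<in>S. dist s x < e)"
      then have "sep e (insert x S)" using S by (auto simp: sep_def dist_commute not_less)
      then have "x \<in> S" using max[of "insert x S"] by auto
      then show False using * e by auto
    qed
    then show ?thesis using S by auto
  qed
  then obtain S where S: "\<And>e. e > 0 \<Longrightarrow> sep e (S e)" "\<And>e x. e > 0 \<Longrightarrow> \<exists>s\<in>S e. dist s x < e"
    by metis
  show thesis
  proof
    show "countable (\<Union>n. S (1 / real (Suc n)))"
      by (intro countable_UN ctble[OF S(1)]) auto
    fix x and e :: real assume "e > 0"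
    then obtain n where n: "1 / real (Suc n) < e" using nat_approx_posE by blast
    then obtain s where "s \<in> S (1 / real (Suc n))" "dist s x < 1 / real (Suc n)"
      using S(2)[of "1 / real (Suc n)" x] by auto
    then show "\<exists>d\<in>\<Union>n. S (1 / real (Suc n)). dist d x < e" using n by (intro bexI[of _ s]) auto
  qed
qed

text \<open>The type is not assumed to be second countable, so a countable dense set is used to write
  \<open>{(x, y). dist x y < r}\<close> as a countable union of products of balls.\<close>

lemma borel_measurable_dist_pair:
  fixes M :: "'a::metric_space measure" and D :: "'a set"
  assumes M[measurable_cong]: "sets M = sets borel"
    and D: "countable D" "\<And>x e. e > 0 \<Longrightarrow> \<exists>d\<in>D. dist d x < e"
  shows "(\<lambda>p. dist (fst p) (snd p)) \<in> borel_measurable (M \<Otimes>\<^sub>M M)"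
proof (rule borel_measurableI_less)
  fix r :: real
  have sp: "space M = UNIV" using sets_eq_imp_space_eq[OF M] by simp
  have "{p \<in> space (M \<Otimes>\<^sub>M M). dist (fst p) (snd p) < r}
      = (\<Union>d\<in>D. \<Union>q\<in>\<rat>. ball d q \<times> ball d (r - q))"
  proof safe
    fix x y :: 'a assume "dist (fst (x, y)) (snd (x, y)) < r"
    then have xy: "0 < (r - dist x y) / 2" by simp
    then obtain d where d: "d \<in> D" "dist d x < (r - dist x y) / 2" using D(2) by blast
    have "dist d y \<le> dist d x + dist x y" by (rule dist_triangle)
    then have "dist d x < r - dist d y" using d by argo
    then obtain q where "q \<in> \<rat>" "dist d x < q" "q < r - dist d y" using Rats_dense_in_real by blast
    then show "(x, y) \<in> (\<Union>d\<in>D. \<Union>q\<in>\<rat>. ball d q \<times> ball d (r - q))" using d by force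
  next
    fix x y d :: 'a and q assume "x \<in> ball d q" "y \<in> ball d (r - q)"
    moreover have "dist x y \<le> dist d x + dist d y" by (rule dist_triangle3)
    ultimately show "dist (fst (x, y)) (snd (x, y)) < r" by simp
  qed (simp add: space_pair_measure sp)
  also have "\<dots> \<in> sets (M \<Otimes>\<^sub>M M)"
    by (intro sets.countable_UN'' D(1) countable_rat) (simp add: pair_measureI M)
  finally show "{p \<in> space (M \<Otimes>\<^sub>M M). dist (fst p) (snd p) < r} \<in> sets (M \<Otimes>\<^sub>M M)" .
qed

section \<open>Hyperbolic geometry and Vitali covering\<close>

lemma strictly_intrinsic_point_between:
  fixes x y :: "'a::metric_space"
  assumes "strictly_intrinsic (UNIV :: 'a set)" and s: "0 \<le> s" "s \<le> dist x y"
  obtains z where "dist x z = s" "dist z y \<le> dist x y - s"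
proof -
  obtain g where g: "path g" "pathstart g = x" "pathfinish g = y"
    and len: "path_length g = ennreal (dist x y)"
    using assms(1) unfolding strictly_intrinsic_def Let_def mem_Collect_eq by (metis UNIV_I)
  have "continuous_on {0..1} (\<lambda>u. dist x (g u))"
    using g(1) by (auto simp: path_def intro!: continuous_intros)
  then obtain u where u: "0 \<le> u" "u \<le> 1" "dist x (g u) = s"
    using IVT'[of "\<lambda>u. dist x (g u)" 0 s 1] g s by (auto simp: pathstart_def pathfinish_def)
  define t where "t i = (if i = 0 then 0 else if i = 1 then u else (1::real))" for i :: nat
  have "(\<Sum>i<2. ennreal (dist (g (t i)) (g (t (Suc i))))) \<le> path_length g"
    unfolding path_length_def
    by (rule SUP_upper2[of "(2, t)"]) (use u in \<open>auto simp: t_def mono_on_def\<close>)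
  then have "ennreal (dist x (g u) + dist (g u) y) \<le> ennreal (dist x y)"
    using g len by (simp add: t_def numeral_2_eq_2 pathstart_def pathfinish_def)
  then have "dist x (g u) + dist (g u) y \<le> dist x y" by (subst (asm) ennreal_le_iff) auto
  then show thesis using that[of "g u"] u by simp
qed

lemma Gromov_hyperbolic_four_point:
  fixes x y z w :: "'a::metric_space"
  assumes "Gromov_hyperbolic \<delta> (UNIV :: 'a set)"
  shows "dist x z + dist w y \<le> max (dist x y + dist w z) (dist y z + dist w x) + 2 * \<delta>"
proof -
  have "Gromov_product w x z \<ge> min (Gromov_product w x y) (Gromov_product w y z) - \<delta>"
    using assms by (simp add: Gromov_hyperbolic_def)
  then show ?thesis unfolding Gromov_product_def by argo
qed

text \<open>This is the only place where hyperbolicity enters. In a tree, let \<open>z\<close> be the point at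
  distance \<open>(n - t) / 2\<close> from \<open>y\<close> on the way to the root \<open>p\<close>: a point \<open>x\<close> at distance less than
  \<open>n\<close> from \<open>y\<close> and at most \<open>t\<close> farther from the root is within \<open>(n + t) / 2\<close> of \<open>z\<close>.\<close>

lemma hyperbolic_half_ball_subset_ball:
  fixes y p :: "'a::metric_space"
  assumes hyp: "Gromov_hyperbolic \<delta> (UNIV :: 'a set)" and intr: "strictly_intrinsic (UNIV :: 'a set)"
    and "0 \<le> \<delta>" and x0: "dist y x0 < n" "dist x0 p \<le> dist y p + t"
  obtains z where "0 \<le> n + t" "{x. dist y x < n \<and> dist x p \<le> dist y p + t} \<subseteq> ball z ((n + t) / 2 + 2 * \<delta> + 1)"
proof -
  have nt: "0 \<le> n + t" using x0 dist_triangle[of y p x0] by simp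
  show thesis
  proof (cases "n \<le> t")
    case True
    then show thesis using \<open>0 \<le> \<delta>\<close> nt by (intro that[of y]) (auto simp: field_simps)
  next
    case False
    define s where "s = min ((n - t) / 2) (dist y p)"
    have "0 \<le> s" "s \<le> dist y p" using False by (auto simp: s_def)
    then obtain z where z: "dist y z = s" "dist z p \<le> dist y p - s"
      using strictly_intrinsic_point_between[OF intr] by metis
    have "dist z x < (n + t) / 2 + 2 * \<delta> + 1" if x: "dist y x < n" "dist x p \<le> dist y p + t" for x
    proof (cases "(n - t) / 2 \<le> dist y p")
      case True
      then have s: "s = (n - t) / 2" by (simp add: s_def)
      have "dist x z + dist p y \<le> max (dist x y + dist p z) (dist y z + dist p x) + 2 * \<delta>"
        by (rule Gromov_hyperbolic_four_point[OF hyp])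
      then show ?thesis using x z s by (simp add: dist_commute max_def field_simps split: if_splits)
    next
      case False
      then have "s = dist y p" by (simp add: s_def)
      then have "z = p" using z by simp
      then show ?thesis using x False \<open>0 \<le> \<delta>\<close> by (simp add: dist_commute field_simps)
    qed
    then show thesis using nt by (intro that[of z]) auto
  qed
qed

text \<open>The index of a ball is the pair of its centre and its radius. A ball of maximal radius is
  selected; enlarged three times, it contains all balls that meet it.\<close>

lemma finite_Vitali_subfamily:
  fixes I :: "('a::metric_space \<times> real) set"
  assumes "finite I" and "\<And>i. i \<in> I \<Longrightarrow> 0 < snd i"
  shows "\<exists>J\<subseteq>I. disjoint_family_on (\<lambda>i. ball (fst i) (snd i)) J \<and>
    (\<Union>i\<in>I. ball (fst i) (snd i)) \<subseteq> (\<Union>j\<in>J. ball (fst j) (3 * snd j))"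
  using assms
proof (induction I rule: finite_psubset_induct)
  case (psubset I)
  show ?case
  proof (cases "I = {}")
    case False
    then obtain k where k: "k \<in> I" "\<And>i. i \<in> I \<Longrightarrow> snd i \<le> snd k"
    proof -
      have "Max (snd ` I) \<in> snd ` I" using False psubset.hyps by (intro Max_in) auto
      then obtain k where "k \<in> I" "snd k = Max (snd ` I)" by auto
      then show thesis using that[of k] psubset.hyps by simp
    qed
    define I' where "I' = {i \<in> I. ball (fst i) (snd i) \<inter> ball (fst k) (snd k) = {}}"
    have "k \<notin> I'" using psubset.prems[OF k(1)] by (auto simp: I'_def)
    moreover have "I' \<subseteq> I" by (auto simp: I'_def)
    ultimately have "I' \<subset> I" using k(1) by blast
    with psubset.IH[of I'] psubset.prems obtain J where J: "J \<subseteq> I'" "disjoint_family_on (\<lambda>i. ball (fst i) (snd i)) J"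
      "(\<Union>i\<in>I'. ball (fst i) (snd i)) \<subseteq> (\<Union>j\<in>J. ball (fst j) (3 * snd j))"
      by blast
    have "ball (fst i) (snd i) \<subseteq> ball (fst k) (3 * snd k)" if i: "i \<in> I" "i \<notin> I'" for i
    proof
      fix y assume y: "y \<in> ball (fst i) (snd i)"
      obtain w where w: "dist (fst i) w < snd i" "dist (fst k) w < snd k"
        using i by (auto simp: I'_def)
      have "dist (fst k) y \<le> dist (fst k) w + (dist w (fst i) + dist (fst i) y)"
        using dist_triangle[of "fst k" y w] dist_triangle[of w y "fst i"] by linarith
      then show "y \<in> ball (fst k) (3 * snd k)"
        using w y k(2)[OF i(1)] by (simp add: dist_commute)
    qed
    then have "(\<Union>i\<in>I. ball (fst i) (snd i)) \<subseteq> (\<Union>j\<in>insert k J. ball (fst j) (3 * snd j))"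
      using J(3) by blast
    moreover have "disjoint_family_on (\<lambda>i. ball (fst i) (snd i)) (insert k J)"
      using J \<open>k \<notin> I'\<close> by (subst disjoint_family_on_insert) (auto simp: I'_def)
    moreover have "insert k J \<subseteq> I" using J k(1) by (auto simp: I'_def)
    ultimately show ?thesis by blast
  qed (auto simp: disjoint_family_on_def)
qed

section \<open>Spaces with pinched exponential growth\<close>

text \<open>A member of the class under consideration with its constants made explicit: \<open>c\<close> and \<open>C\<close> are
  those of the growth condition, and \<open>L\<close> is a doubling constant for radii up to 2.\<close>

locale pinched_hyperbolic_space =
  fixes M :: "'a::metric_space measure" and a b \<tau> \<delta> c C L :: real
  assumes sets_M [measurable_cong, simp]: "sets M = sets borel"
    and one_less_a: "1 < a" and a_le_b: "a \<le> b" and b_less_a_squared: "b < a\<^sup>2"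
    and tau_eq: "\<tau> = log a b"
    and delta_nonneg: "0 \<le> \<delta>" and c_pos: "0 < c" and C_pos: "0 < C" and L_pos: "0 < L"
    and hyperbolic: "Gromov_hyperbolic \<delta> (UNIV :: 'a set)"
    and intrinsic: "strictly_intrinsic (UNIV :: 'a set)"
    and ball_lower: "\<And>x r. 1 \<le> r \<Longrightarrow> ennreal (c * a powr r) \<le> emeasure M (ball x r)"
    and ball_upper: "\<And>x r. 1 \<le> r \<Longrightarrow> emeasure M (ball x r) \<le> ennreal (C * b powr r)"
    and doubling: "\<And>x r. 0 < r \<Longrightarrow> r \<le> 2 \<Longrightarrow>
      emeasure M (ball x (2 * r)) \<le> ennreal L * emeasure M (ball x r)"
begin

lemma space_M [simp]: "space M = UNIV"
  using sets_eq_imp_space_eq[OF sets_M] by simp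

lemma ball_in_sets [measurable, simp]: "ball x r \<in> sets M"
  by simp

lemma one_less_b: "1 < b"
  using one_less_a a_le_b by simp

lemma emeasure_ball_finite: "emeasure M (ball x r) < \<infinity>"
proof -
  have "emeasure M (ball x r) \<le> emeasure M (ball x (max 1 r))"
    by (intro emeasure_mono) auto
  also have "\<dots> \<le> ennreal (C * b powr max 1 r)" by (rule ball_upper) simp
  finally show ?thesis by (simp add: order_le_less_trans)
qed

text \<open>If a ball were null, then by doubling so would be a concentric ball of radius at least 1.\<close>

lemma emeasure_ball_pos: "0 < r \<Longrightarrow> 0 < emeasure M (ball x r)"
proof (rule ccontr)
  assume r: "0 < r" and "\<not> 0 < emeasure M (ball x r)"
  then have zero: "emeasure M (ball x r) = 0" by simp
  have pow: "emeasure M (ball x (2 ^ n * r)) = 0 \<or> 1 \<le> 2 ^ n * r" for n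
  proof (induction n)
    case (Suc n)
    have "emeasure M (ball x (2 * (2 ^ n * r))) = 0" if "2 ^ n * r < 1"
      using Suc that doubling[of "2 ^ n * r" x] r by auto
    then show ?case using Suc r by (cases "2 ^ n * r < 1") (auto simp: mult.assoc)
  qed (simp add: zero)
  obtain n where n: "1 / r < 2 ^ n" using real_arch_pow[of 2 "1 / r"] by auto
  define k where "k = (LEAST n. 1 \<le> 2 ^ n * r)"
  have "1 \<le> 2 ^ n * r" using n r by (simp add: field_simps)
  then have k: "1 \<le> 2 ^ k * r" unfolding k_def by (rule LeastI)
  have "emeasure M (ball x (2 ^ k * r)) = 0"
  proof (cases k)
    case (Suc j)
    then have "\<not> 1 \<le> 2 ^ j * r" unfolding k_def using not_less_Least by (metis lessI)
    then show ?thesis using pow[of j] doubling[of "2 ^ j * r" x] r Suc by (auto simp: mult.assoc)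
  qed (simp add: zero)
  moreover have "0 < ennreal (c * a powr (2 ^ k * r))" using c_pos one_less_a by simp
  ultimately show False using ball_lower[OF k, of x] by (simp add: order.strict_iff_not)
qed

sublocale sigma_finite_measure M
proof
  show "\<exists>A. countable A \<and> A \<subseteq> sets M \<and> \<Union>A = space M \<and> (\<forall>a\<in>A. emeasure M a \<noteq> \<infinity>)"
  proof (intro exI[of _ "range (\<lambda>n. ball undefined (real n))"] conjI)
    show "\<Union>(range (\<lambda>n. ball undefined (real n))) = space M"
      using reals_Archimedean2 by auto
    show "\<forall>a\<in>range (\<lambda>n. ball undefined (real n)). emeasure M a \<noteq> \<infinity>"
      using emeasure_ball_finite by (auto simp: less_top)
  qed auto
qed

sublocale square: pair_sigma_finite M M ..

lemma measurable_dist_M [measurable (raw)]: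
  assumes [measurable]: "f \<in> N \<rightarrow>\<^sub>M M" "h \<in> N \<rightarrow>\<^sub>M M"
  shows "(\<lambda>w. dist (f w) (h w)) \<in> borel_measurable N"
proof -
  obtain D :: "'a set" where "countable D" "\<And>x e. e > 0 \<Longrightarrow> \<exists>d\<in>D. dist d x < e"
    using countable_dense_if_balls_pos_finite[of M] emeasure_ball_pos emeasure_ball_finite sets_M by metis
  then have [measurable]: "(\<lambda>p. dist (fst p) (snd p)) \<in> borel_measurable (M \<Otimes>\<^sub>M M)"
    using borel_measurable_dist_pair[OF sets_M] by blast
  have "(\<lambda>w. (\<lambda>p. dist (fst p) (snd p)) (f w, h w)) \<in> borel_measurable N"
    by measurable
  then show ?thesis by simp
qed

lemma measurable_indicator_ball [measurable (raw)]:
  assumes [measurable]: "f \<in> N \<rightarrow>\<^sub>M M" "h \<in> N \<rightarrow>\<^sub>M M"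
  shows "(\<lambda>w. indicator (ball (f w) r) (h w) :: ennreal) \<in> borel_measurable N"
proof -
  have "(\<lambda>w. if dist (f w) (h w) < r then 1 else 0 :: ennreal) \<in> borel_measurable N"
    by measurable
  then show ?thesis by (simp add: indicator_def mem_ball)
qed

text \<open>Tonelli's theorem: the operator \<open>f \<mapsto> (\<lambda>y. \<integral>\<^sup>+x\<in>ball y r. f x \<partial>M)\<close> is symmetric.\<close>

lemma ball_integral_swap:
  assumes [measurable]: "f \<in> borel_measurable M" "h \<in> borel_measurable M"
  shows "(\<integral>\<^sup>+x. f x * (\<integral>\<^sup>+y\<in>ball x r. h y \<partial>M) \<partial>M) = (\<integral>\<^sup>+y. h y * (\<integral>\<^sup>+x\<in>ball y r. f x \<partial>M) \<partial>M)"
proof -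
  have "(\<integral>\<^sup>+x. f x * (\<integral>\<^sup>+y\<in>ball x r. h y \<partial>M) \<partial>M) = (\<integral>\<^sup>+x. \<integral>\<^sup>+y. f x * (h y * indicator (ball x r) y) \<partial>M \<partial>M)"
    by (intro nn_integral_cong nn_integral_cmult[symmetric]) measurable
  also have "\<dots> = (\<integral>\<^sup>+y. \<integral>\<^sup>+x. f x * (h y * indicator (ball x r) y) \<partial>M \<partial>M)"
    by (rule square.Fubini'[symmetric]) measurable
  also have "\<dots> = (\<integral>\<^sup>+y. \<integral>\<^sup>+x. h y * (f x * indicator (ball y r) x) \<partial>M \<partial>M)"
    by (intro nn_integral_cong) (auto simp: dist_commute mult_ac split: split_indicator)
  also have "\<dots> = (\<integral>\<^sup>+y. h y * (\<integral>\<^sup>+x\<in>ball y r. f x \<partial>M) \<partial>M)"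
    by (intro nn_integral_cong nn_integral_cmult) measurable
  finally show ?thesis .
qed

text \<open>Weak type (1,1) for radii at most 1. The exceptional set is enclosed in a
  measurable set \<open>U\<close>, which makes its own measurability irrelevant. Separability yields a countable subcover by balls
  \<open>ball x (\<rho> x)\<close>, to whose finite subfamilies the Vitali lemma applies.\<close>

lemma local_covering_estimate:
  assumes g [measurable]: "g \<in> borel_measurable M"
  obtains U where "U \<in> sets M"
    and "{x. \<exists>r. 0 < r \<and> r \<le> 1 \<and> emeasure M (ball x r) < (\<integral>\<^sup>+y\<in>ball x r. g y \<partial>M)} \<subseteq> U"
    and "emeasure M U \<le> ennreal (L\<^sup>2) * (\<integral>\<^sup>+y. g y \<partial>M)"
proof -
  define A where "A = {x. \<exists>r. 0 < r \<and> r \<le> 1 \<and> emeasure M (ball x r) < (\<integral>\<^sup>+y\<in>ball x r. g y \<partial>M)}"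
  show thesis
  proof (cases "A = {}")
    case True
    then show thesis using that[of "{}"] unfolding A_def by auto
  next
    case False
    obtain \<rho> where \<rho>: "0 < \<rho> x" "\<rho> x \<le> 1" "emeasure M (ball x (\<rho> x)) < (\<integral>\<^sup>+y\<in>ball x (\<rho> x). g y \<partial>M)"
      if "x \<in> A" for x
    proof -
      have "\<forall>x. \<exists>r. x \<in> A \<longrightarrow> 0 < r \<and> r \<le> 1 \<and> emeasure M (ball x r) < (\<integral>\<^sup>+y\<in>ball x r. g y \<partial>M)"
        by (auto simp: A_def)
      then show thesis using that by metis
    qed
    obtain D :: "'a set" where D: "countable D" "\<And>x e. e > 0 \<Longrightarrow> \<exists>d\<in>D. dist d x < e"
      using countable_dense_if_balls_pos_finite[of M] emeasure_ball_pos emeasure_ball_finite sets_M by metis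
    define P where "P = {p \<in> D \<times> \<rat>. \<exists>x\<in>A. ball (fst p) (snd p) \<subseteq> ball x (\<rho> x)}"
    have P: "countable P"
      by (rule countable_subset[of _ "D \<times> \<rat>"]) (auto simp: P_def D countable_rat)
    obtain \<xi> where \<xi>: "\<xi> p \<in> A" "ball (fst p) (snd p) \<subseteq> ball (\<xi> p) (\<rho> (\<xi> p))" if "p \<in> P" for p
    proof -
      have "\<forall>p. \<exists>x. p \<in> P \<longrightarrow> x \<in> A \<and> ball (fst p) (snd p) \<subseteq> ball x (\<rho> x)"
        by (auto simp: P_def)
      then show thesis using that by metis
    qed
    have cov: "A \<subseteq> (\<Union>x\<in>\<xi> ` P. ball x (\<rho> x))"
    proof
      fix x assume x: "x \<in> A"
      obtain q where q: "q \<in> \<rat>" "0 < q" "q < \<rho> x / 2"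
        using Rats_dense_in_real[of 0 "\<rho> x / 2"] \<rho>(1)[OF x] by auto
      obtain d where d: "d \<in> D" "dist d x < q" using D(2) q by blast
      have "ball d q \<subseteq> ball x (\<rho> x)"
      proof
        fix y assume "y \<in> ball d q"
        then show "y \<in> ball x (\<rho> x)" using d q dist_triangle[of x y d] by (simp add: dist_commute)
      qed
      then have "(d, q) \<in> P" using d q x by (auto simp: P_def)
      moreover have "x \<in> ball d q" using d by simp
      ultimately show "x \<in> (\<Union>x\<in>\<xi> ` P. ball x (\<rho> x))" using \<xi>(2)[of "(d, q)"]
        by (intro UN_I[of "\<xi> (d, q)"]) auto
    qed
    have "\<xi> ` P \<noteq> {}" using cov False by auto
    then obtain e :: "nat \<Rightarrow> 'a" where e: "range e = \<xi> ` P"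
      using P by (metis countable_image uncountable_def)
    then have eA: "e i \<in> A" for i using \<xi>(1) by (metis imageE rangeI)
    define V where "V n = (\<Union>i\<le>n. ball (e i) (\<rho> (e i)))" for n
    have V: "range V \<subseteq> sets M" unfolding V_def by auto
    have "emeasure M (V n) \<le> ennreal (L\<^sup>2) * (\<integral>\<^sup>+y. g y \<partial>M)" for n
    proof -
      define I where "I = (\<lambda>i. (e i, \<rho> (e i))) ` {..n}"
      have "finite I" "\<And>i. i \<in> I \<Longrightarrow> 0 < snd i" using \<rho>(1)[OF eA] by (auto simp: I_def)
      then obtain J where J: "J \<subseteq> I" and disj: "disjoint_family_on (\<lambda>i. ball (fst i) (snd i)) J"
        and covJ: "(\<Union>i\<in>I. ball (fst i) (snd i)) \<subseteq> (\<Union>j\<in>J. ball (fst j) (3 * snd j))"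
        using finite_Vitali_subfamily[of I] by blast
      have finJ: "finite J" using J by (rule finite_subset) (simp add: I_def)
      have Jp: "0 < snd j" "snd j \<le> 1" "emeasure M (ball (fst j) (snd j)) \<le> (\<integral>\<^sup>+y\<in>ball (fst j) (snd j). g y \<partial>M)"
        if j: "j \<in> J" for j
      proof -
        obtain i where "j = (e i, \<rho> (e i))" using j J by (auto simp: I_def)
        then show "0 < snd j" "snd j \<le> 1"
          "emeasure M (ball (fst j) (snd j)) \<le> (\<integral>\<^sup>+y\<in>ball (fst j) (snd j). g y \<partial>M)"
          using \<rho>[OF eA[of i]] by auto
      qed
      have "V n \<subseteq> (\<Union>j\<in>J. ball (fst j) (3 * snd j))"
        using covJ by (auto simp: V_def I_def)
      then have "emeasure M (V n) \<le> emeasure M (\<Union>j\<in>J. ball (fst j) (3 * snd j))"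
        using finJ by (intro emeasure_mono sets.finite_UN) auto
      also have "\<dots> \<le> (\<Sum>j\<in>J. emeasure M (ball (fst j) (3 * snd j)))"
        by (intro emeasure_subadditive_finite finJ) auto
      also have "\<dots> \<le> (\<Sum>j\<in>J. ennreal (L\<^sup>2) * (\<integral>\<^sup>+y\<in>ball (fst j) (snd j). g y \<partial>M))"
      proof (rule sum_mono)
        fix j assume j: "j \<in> J"
        have "emeasure M (ball (fst j) (3 * snd j)) \<le> emeasure M (ball (fst j) (2 * (2 * snd j)))"
          using Jp(1)[OF j] by (intro emeasure_mono) auto
        also have "\<dots> \<le> ennreal L * emeasure M (ball (fst j) (2 * snd j))"
          using Jp[OF j] by (intro doubling) auto
        also have "\<dots> \<le> ennreal L * (ennreal L * emeasure M (ball (fst j) (snd j)))"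
          using Jp[OF j] by (intro mult_left_mono doubling) auto
        also have "\<dots> = ennreal (L\<^sup>2) * emeasure M (ball (fst j) (snd j))"
          using L_pos by (simp add: power2_eq_square ennreal_mult mult.assoc)
        also have "\<dots> \<le> ennreal (L\<^sup>2) * (\<integral>\<^sup>+y\<in>ball (fst j) (snd j). g y \<partial>M)"
          using Jp(3)[OF j] by (intro mult_left_mono) auto
        finally show "emeasure M (ball (fst j) (3 * snd j)) \<le> \<dots>" .
      qed
      also have "\<dots> = ennreal (L\<^sup>2) * (\<integral>\<^sup>+y. (\<Sum>j\<in>J. g y * indicator (ball (fst j) (snd j)) y) \<partial>M)"
        by (simp add: sum_distrib_left nn_integral_sum)
      also have "\<dots> \<le> ennreal (L\<^sup>2) * (\<integral>\<^sup>+y. g y \<partial>M)"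
      proof (intro mult_left_mono nn_integral_mono)
        fix y
        have "(\<Sum>j\<in>J. g y * indicator (ball (fst j) (snd j)) y)
            = g y * indicator (\<Union>j\<in>J. ball (fst j) (snd j)) y"
          by (subst indicator_UN_disjoint[OF finJ disj]) (simp add: sum_distrib_left)
        then show "(\<Sum>j\<in>J. g y * indicator (ball (fst j) (snd j)) y) \<le> g y"
          by (simp split: split_indicator)
      qed simp
      finally show ?thesis .
    qed
    moreover have "incseq V" by (auto simp: incseq_def V_def intro: order_trans)
    ultimately have "emeasure M (\<Union>n. V n) \<le> ennreal (L\<^sup>2) * (\<integral>\<^sup>+y. g y \<partial>M)"
      by (subst SUP_emeasure_incseq[OF V, symmetric]) (auto intro: SUP_least)
    moreover have "A \<subseteq> (\<Union>n. V n)"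
      using cov unfolding e[symmetric] V_def by blast
    moreover have "(\<Union>n. V n) \<in> sets M" using V by blast
    ultimately show thesis using that[of "\<Union>n. V n"] unfolding A_def by blast
  qed
qed

end

section \<open>The weak type estimate for functions with light unit balls\<close>

context pinched_hyperbolic_space
begin

lemma emeasure_half_ball_lower: "ennreal (c / L) \<le> emeasure M (ball x (1/2))"
proof -
  have "ennreal (c * a powr 1) \<le> ennreal L * emeasure M (ball x (1/2))"
    using order_trans[OF ball_lower[of 1 x]] doubling[of "1/2" x] by simp
  moreover have "ennreal c \<le> ennreal (c * a powr 1)"
    using c_pos one_less_a by (intro ennreal_leI) simp
  ultimately have "ennreal c \<le> ennreal L * emeasure M (ball x (1/2))" by simp
  then have "ennreal c / ennreal L \<le> ennreal L * emeasure M (ball x (1/2)) / ennreal L"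
    by (rule divide_right_mono_ennreal)
  also have "\<dots> = emeasure M (ball x (1/2))"
    using L_pos by (simp add: mult.commute[of "ennreal L"] ennreal_mult_divide_eq)
  finally show ?thesis using c_pos L_pos by (simp add: divide_ennreal)
qed

text \<open>A density whose integral over each unit ball centred in its support is at most \<open>m\<close> obeys,
  up to a constant, the same growth bound on large balls as \<open>m\<close> times the measure.\<close>

lemma ball_integral_le_if_unit_balls_light:
  assumes [measurable]: "u \<in> borel_measurable M" and "0 < m"
    and light: "\<And>y. u y \<noteq> 0 \<Longrightarrow> (\<integral>\<^sup>+x\<in>ball y 1. u x \<partial>M) \<le> ennreal m"
    and R: "0 \<le> R"
  shows "(\<integral>\<^sup>+y\<in>ball z R. u y \<partial>M) \<le> ennreal (L / c * C * m * b powr (R + 1))"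
proof -
  define v where "v y = u y * indicator (ball z R) y" for y
  have [measurable]: "v \<in> borel_measurable M" unfolding v_def by measurable
  have "ennreal (c / L) * (\<integral>\<^sup>+y. v y \<partial>M) = (\<integral>\<^sup>+y. v y * ennreal (c / L) \<partial>M)"
    by (subst nn_integral_multc) (simp_all add: mult.commute)
  also have "\<dots> \<le> (\<integral>\<^sup>+y. v y * (\<integral>\<^sup>+x\<in>ball y (1/2). 1 \<partial>M) \<partial>M)"
    using emeasure_half_ball_lower by (intro nn_integral_mono mult_left_mono) simp_all
  also have "\<dots> = (\<integral>\<^sup>+x. 1 * (\<integral>\<^sup>+y\<in>ball x (1/2). v y \<partial>M) \<partial>M)"
    by (rule ball_integral_swap) measurable
  also have "\<dots> \<le> (\<integral>\<^sup>+x. ennreal m * indicator (ball z (R + 1)) x \<partial>M)"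
  proof (intro nn_integral_mono)
    fix x
    show "1 * (\<integral>\<^sup>+y\<in>ball x (1/2). v y \<partial>M) \<le> ennreal m * indicator (ball z (R + 1)) x"
    proof (cases "\<exists>y\<in>ball x (1/2). v y \<noteq> 0")
      case True
      then obtain w where w: "dist x w < 1/2" "u w \<noteq> 0" "dist z w < R"
        by (auto simp: v_def split: split_indicator_asm)
      have "(\<integral>\<^sup>+y\<in>ball x (1/2). v y \<partial>M) \<le> (\<integral>\<^sup>+y\<in>ball w 1. u y \<partial>M)"
      proof (intro nn_integral_mono)
        fix y
        show "v y * indicator (ball x (1/2)) y \<le> u y * indicator (ball w 1) y"
          using w(1) dist_triangle[of w y x] by (auto simp: v_def dist_commute split: split_indicator)
      qed
      moreover have "x \<in> ball z (R + 1)"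
        using w dist_triangle[of z x w] by (simp add: dist_commute)
      ultimately show ?thesis using light[OF w(2)] by simp
    next
      case False
      then have "(\<integral>\<^sup>+y\<in>ball x (1/2). v y \<partial>M) = (\<integral>\<^sup>+y. 0 \<partial>M)"
        by (intro nn_integral_cong) (auto split: split_indicator)
      then show ?thesis by simp
    qed
  qed
  also have "\<dots> = ennreal m * emeasure M (ball z (R + 1))"
    by (rule nn_integral_cmult_indicator) simp
  also have "\<dots> \<le> ennreal m * ennreal (C * b powr (R + 1))"
    using R by (intro mult_left_mono ball_upper) auto
  also have "\<dots> = ennreal (c / L) * ennreal (L / c * C * m * b powr (R + 1))"
    using \<open>0 < m\<close> C_pos c_pos L_pos by (simp flip: ennreal_mult')
  finally show ?thesis
    using c_pos L_pos unfolding v_def by (subst (asm) ennreal_mult_le_mult_iff) auto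
qed

lemma nn_integral_ball_integral_le:
  assumes [measurable]: "u \<in> borel_measurable M" and n: "1 \<le> n"
  shows "(\<integral>\<^sup>+x. (\<integral>\<^sup>+y\<in>ball x n. u y \<partial>M) \<partial>M) \<le> ennreal (C * b powr n) * (\<integral>\<^sup>+y. u y \<partial>M)"
proof -
  have "(\<integral>\<^sup>+x. (\<integral>\<^sup>+y\<in>ball x n. u y \<partial>M) \<partial>M) = (\<integral>\<^sup>+x. 1 * (\<integral>\<^sup>+y\<in>ball x n. u y \<partial>M) \<partial>M)"
    by simp
  also have "\<dots> = (\<integral>\<^sup>+y. u y * (\<integral>\<^sup>+x\<in>ball y n. 1 \<partial>M) \<partial>M)"
    by (rule ball_integral_swap) measurable
  also have "\<dots> \<le> (\<integral>\<^sup>+y. u y * ennreal (C * b powr n) \<partial>M)"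
    using ball_upper[OF n] by (intro nn_integral_mono mult_left_mono) simp_all
  also have "\<dots> = ennreal (C * b powr n) * (\<integral>\<^sup>+y. u y \<partial>M)"
    by (subst nn_integral_multc) (simp_all add: mult.commute)
  finally show ?thesis .
qed

lemma half_ball_subset_ball:
  fixes y p :: 'a
  assumes "{x. dist y x < n \<and> dist x p \<le> dist y p + t} \<noteq> {}"
  obtains z where "0 \<le> n + t" "{x. dist y x < n \<and> dist x p \<le> dist y p + t} \<subseteq> ball z ((n + t) / 2 + 2 * \<delta> + 1)"
  using assms hyperbolic_half_ball_subset_ball[OF hyperbolic intrinsic delta_nonneg, of y _ n p t] by auto

text \<open>The factors in the bounds for the measure and the integral over a half ball.\<close>

definition K\<^sub>1 :: real where "K\<^sub>1 = C * b powr (2 * \<delta> + 1)"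

definition K\<^sub>2 :: real where "K\<^sub>2 = L / c * C * b powr (2 * \<delta> + 2)"

lemma K_pos: "0 < K\<^sub>1" "0 < K\<^sub>2"
  using C_pos c_pos L_pos one_less_b by (auto simp: K\<^sub>1_def K\<^sub>2_def)

lemma emeasure_half_ball_le:
  fixes y p :: 'a
  shows "emeasure M {x. dist y x < n \<and> dist x p \<le> dist y p + t} \<le> ennreal (K\<^sub>1 * b powr ((n + t) / 2))"
proof (cases "{x. dist y x < n \<and> dist x p \<le> dist y p + t} = {}")
  case False
  then obtain z where nt: "0 \<le> n + t" and z: "{x. dist y x < n \<and> dist x p \<le> dist y p + t} \<subseteq> ball z ((n + t) / 2 + 2 * \<delta> + 1)"
    using half_ball_subset_ball by blast
  have "emeasure M {x. dist y x < n \<and> dist x p \<le> dist y p + t} \<le> emeasure M (ball z ((n + t) / 2 + 2 * \<delta> + 1))"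
    by (intro emeasure_mono z) simp
  also have "\<dots> \<le> ennreal (C * b powr ((n + t) / 2 + 2 * \<delta> + 1))"
    using nt delta_nonneg by (intro ball_upper) simp
  also have "C * b powr ((n + t) / 2 + 2 * \<delta> + 1) = K\<^sub>1 * b powr ((n + t) / 2)"
    by (simp add: K\<^sub>1_def powr_add)
  finally show ?thesis .
next
  case True
  then show ?thesis unfolding True by simp
qed

lemma half_ball_integral_le_if_unit_balls_light:
  fixes y p :: 'a
  assumes u: "u \<in> borel_measurable M" and m: "0 < m"
    and light: "\<And>y. u y \<noteq> 0 \<Longrightarrow> (\<integral>\<^sup>+x\<in>ball y 1. u x \<partial>M) \<le> ennreal m"
  shows "(\<integral>\<^sup>+x\<in>{x. dist y x < n \<and> dist x p \<le> dist y p + t}. u x \<partial>M) \<le> ennreal (K\<^sub>2 * m * b powr ((n + t) / 2))"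
proof (cases "{x. dist y x < n \<and> dist x p \<le> dist y p + t} = {}")
  case False
  then obtain z where nt: "0 \<le> n + t" and z: "{x. dist y x < n \<and> dist x p \<le> dist y p + t} \<subseteq> ball z ((n + t) / 2 + 2 * \<delta> + 1)"
    using half_ball_subset_ball by blast
  have "(\<integral>\<^sup>+x\<in>{x. dist y x < n \<and> dist x p \<le> dist y p + t}. u x \<partial>M) \<le> (\<integral>\<^sup>+x\<in>ball z ((n + t) / 2 + 2 * \<delta> + 1). u x \<partial>M)"
    using z by (intro nn_integral_mono) (auto split: split_indicator)
  also have "\<dots> \<le> ennreal (L / c * C * m * b powr ((n + t) / 2 + 2 * \<delta> + 1 + 1))"
    using nt delta_nonneg by (intro ball_integral_le_if_unit_balls_light u m light) auto
  also have "L / c * C * m * b powr ((n + t) / 2 + 2 * \<delta> + 1 + 1) = K\<^sub>2 * m * b powr ((n + t) / 2)"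
    using powr_add[of b "(n + t) / 2" "2 * \<delta> + 2"] by (simp add: K\<^sub>2_def add.assoc mult_ac)
  finally show ?thesis .
next
  case True
  then show ?thesis unfolding True by simp
qed

text \<open>The pairs \<open>(x, y)\<close> with \<open>x\<close> in the exceptional set and \<open>dist x y < n\<close> are split according to whether \<open>x\<close> is
  farther from the base point \<open>p\<close> than \<open>y\<close> by more than \<open>t\<close>. Each half is a half ball in one of
  the variables. The value of \<open>t\<close> makes the second half absorb at most half of the left-hand side.\<close>

lemma ball_integral_weak_type_if_unit_balls_light:
  assumes u [measurable]: "u \<in> borel_measurable M" and m: "0 < m"
    and light: "\<And>y. u y \<noteq> 0 \<Longrightarrow> (\<integral>\<^sup>+x\<in>ball y 1. u x \<partial>M) \<le> ennreal m"
    and fin: "(\<integral>\<^sup>+y. u y \<partial>M) < \<infinity>" and \<theta>: "0 < \<theta>" and n: "1 \<le> n"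
  shows "emeasure M {x. ennreal \<theta> < (\<integral>\<^sup>+y\<in>ball x n. u y \<partial>M)}
    \<le> ennreal (4 * K\<^sub>1 * K\<^sub>2 * b powr n * m / \<theta>\<^sup>2) * (\<integral>\<^sup>+y. u y \<partial>M)"
proof -
  define E where "E = {x. ennreal \<theta> < (\<integral>\<^sup>+y\<in>ball x n. u y \<partial>M)}"
  have E [measurable]: "E \<in> sets M"
    unfolding E_def using ball_integral_lower_semicontinuous[OF sets_M u] by simp
  define p :: 'a where "p = undefined"
  define t where "t = n - 2 * log b (\<theta> / (2 * K\<^sub>2 * m))"
  have t: "b powr ((n - t) / 2) = \<theta> / (2 * K\<^sub>2 * m)"
    using one_less_b \<theta> K_pos m by (simp add: t_def)
  have "b powr ((n + t) / 2) * b powr ((n - t) / 2) = b powr n"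
    by (simp add: powr_add[symmetric] field_simps)
  then have t': "b powr ((n + t) / 2) = 2 * K\<^sub>2 * m * b powr n / \<theta>"
    using \<theta> K_pos m by (simp add: t field_simps)
  define I where "I = (\<integral>\<^sup>+y. u y \<partial>M)"
  have low: "ennreal \<theta> * emeasure M E \<le> (\<integral>\<^sup>+x. indicator E x * (\<integral>\<^sup>+y\<in>ball x n. u y \<partial>M) \<partial>M)"
  proof -
    have "ennreal \<theta> * emeasure M E = (\<integral>\<^sup>+x. ennreal \<theta> * indicator E x \<partial>M)"
      by (rule nn_integral_cmult_indicator[symmetric]) (rule E)
    also have "\<dots> \<le> (\<integral>\<^sup>+x. indicator E x * (\<integral>\<^sup>+y\<in>ball x n. u y \<partial>M) \<partial>M)"
      by (intro nn_integral_mono) (auto simp: E_def split: split_indicator)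
    finally show ?thesis .
  qed
  also have "\<dots> \<le> (\<integral>\<^sup>+x. (\<integral>\<^sup>+y\<in>ball x n. u y \<partial>M) \<partial>M)"
    by (intro nn_integral_mono) (auto split: split_indicator)
  also have "\<dots> \<le> ennreal (C * b powr n) * I"
    unfolding I_def by (rule nn_integral_ball_integral_le[OF u n])
  also have "\<dots> < \<infinity>" using fin by (simp add: I_def ennreal_mult_less_top)
  finally have finE: "emeasure M E < \<infinity>"
    using \<theta> by (auto simp: ennreal_mult_less_top)
  define P where "P x y \<longleftrightarrow> dist x p \<le> dist y p + t" for x y
  have [measurable]: "Measurable.pred (M \<Otimes>\<^sub>M M) (\<lambda>w. P (fst w) (snd w))"
    unfolding P_def by measurable
  have [measurable]: "Measurable.pred (M \<Otimes>\<^sub>M M) (\<lambda>w. P (snd w) (fst w))" "Measurable.pred M (\<lambda>x. P x y)"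
      "Measurable.pred M (\<lambda>y. P x y)" for x y
    unfolding P_def by measurable
  define F where "F x y = indicator E x * (u y * indicator (ball x n) y)" for x y
  have [measurable]: "case_prod F \<in> borel_measurable (M \<Otimes>\<^sub>M M)" unfolding F_def by measurable
  have [measurable]: "F x \<in> borel_measurable M" for x unfolding F_def by measurable
  have "(\<integral>\<^sup>+x. indicator E x * (\<integral>\<^sup>+y\<in>ball x n. u y \<partial>M) \<partial>M) = (\<integral>\<^sup>+x. \<integral>\<^sup>+y. F x y \<partial>M \<partial>M)"
    unfolding F_def by (intro nn_integral_cong nn_integral_cmult[symmetric]) measurable
  also have "\<dots> = (\<integral>\<^sup>+x. (\<integral>\<^sup>+y. F x y * (if P x y then 1 else 0) \<partial>M) + (\<integral>\<^sup>+y. F x y * (if P x y then 0 else 1) \<partial>M) \<partial>M)"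
    by (intro nn_integral_cong, subst nn_integral_add[symmetric]) (auto intro!: nn_integral_cong)
  also have "\<dots> = (\<integral>\<^sup>+x. \<integral>\<^sup>+y. F x y * (if P x y then 1 else 0) \<partial>M \<partial>M) + (\<integral>\<^sup>+x. \<integral>\<^sup>+y. F x y * (if P x y then 0 else 1) \<partial>M \<partial>M)"
    by (rule nn_integral_add) measurable
  also have "(\<integral>\<^sup>+x. \<integral>\<^sup>+y. F x y * (if P x y then 1 else 0) \<partial>M \<partial>M)
      = (\<integral>\<^sup>+y. \<integral>\<^sup>+x. F x y * (if P x y then 1 else 0) \<partial>M \<partial>M)"
    by (rule square.Fubini'[symmetric]) measurable
  also have "\<dots> \<le> (\<integral>\<^sup>+y. u y * ennreal (K\<^sub>1 * b powr ((n + t) / 2)) \<partial>M)"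
  proof (intro nn_integral_mono)
    fix y
    have "(\<integral>\<^sup>+x. F x y * (if P x y then 1 else 0) \<partial>M)
        \<le> (\<integral>\<^sup>+x. u y * indicator {x. dist y x < n \<and> dist x p \<le> dist y p + t} x \<partial>M)"
      by (intro nn_integral_mono) (auto simp: F_def P_def dist_commute split: split_indicator)
    also have "\<dots> = u y * emeasure M {x. dist y x < n \<and> dist x p \<le> dist y p + t}"
      by (rule nn_integral_cmult_indicator) measurable
    also have "\<dots> \<le> u y * ennreal (K\<^sub>1 * b powr ((n + t) / 2))"
      by (intro mult_left_mono emeasure_half_ball_le) simp
    finally show "(\<integral>\<^sup>+x. F x y * (if P x y then 1 else 0) \<partial>M) \<le> \<dots>" .
  qed
  also have "\<dots> = I * ennreal (K\<^sub>1 * b powr ((n + t) / 2))"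
    unfolding I_def by (rule nn_integral_multc) measurable
  also have "(\<integral>\<^sup>+x. \<integral>\<^sup>+y. F x y * (if P x y then 0 else 1) \<partial>M \<partial>M)
     \<le> (\<integral>\<^sup>+x. ennreal (K\<^sub>2 * m * b powr ((n - t) / 2)) * indicator E x \<partial>M)"
  proof (intro nn_integral_mono)
    fix x
    have "(\<integral>\<^sup>+y. F x y * (if P x y then 0 else 1) \<partial>M)
        \<le> (\<integral>\<^sup>+y. indicator E x * (u y * indicator {y. dist x y < n \<and> dist y p \<le> dist x p + - t} y) \<partial>M)"
      by (intro nn_integral_mono) (auto simp: F_def P_def split: split_indicator)
    also have "\<dots> = indicator E x * (\<integral>\<^sup>+y\<in>{y. dist x y < n \<and> dist y p \<le> dist x p + - t}. u y \<partial>M)"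
      by (rule nn_integral_cmult) measurable
    also have "\<dots> \<le> indicator E x * ennreal (K\<^sub>2 * m * b powr ((n + - t) / 2))"
      by (intro mult_left_mono half_ball_integral_le_if_unit_balls_light u m light) simp_all
    finally show "(\<integral>\<^sup>+y. F x y * (if P x y then 0 else 1) \<partial>M) \<le> ennreal (K\<^sub>2 * m * b powr ((n - t) / 2)) * indicator E x"
      by (simp add: mult.commute)
  qed
  also have "\<dots> = ennreal (K\<^sub>2 * m * b powr ((n - t) / 2)) * emeasure M E"
    by (rule nn_integral_cmult_indicator) measurable
  finally have main: "ennreal \<theta> * emeasure M E \<le> I * ennreal (K\<^sub>1 * b powr ((n + t) / 2)) + ennreal (\<theta> / 2) * emeasure M E"
    using order_trans[OF low] m K_pos by (simp add: add_mono t)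
  obtain A where A: "emeasure M E = ennreal A" "0 \<le> A" using finE by (cases "emeasure M E") auto
  obtain J where J: "I = ennreal J" "0 \<le> J" using fin by (cases I) (auto simp: I_def)
  define X where "X = K\<^sub>1 * b powr ((n + t) / 2)"
  have "0 \<le> X" using K_pos by (simp add: X_def)
  then have "ennreal (J * X + \<theta> / 2 * A) = ennreal J * ennreal X + ennreal (\<theta> / 2) * ennreal A"
    using A J \<theta> by (subst ennreal_plus, simp, simp, subst (1 2) ennreal_mult) simp_all
  then have "ennreal (\<theta> * A) \<le> ennreal (J * (K\<^sub>1 * b powr ((n + t) / 2)) + \<theta> / 2 * A)"
    using main A J \<theta> unfolding X_def by (simp add: ennreal_mult)
  then have "\<theta> * A \<le> J * (K\<^sub>1 * b powr ((n + t) / 2)) + \<theta> / 2 * A"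
    using A J \<theta> K_pos by (subst (asm) ennreal_le_iff) auto
  then have "A \<le> 4 * K\<^sub>1 * K\<^sub>2 * b powr n * m / \<theta>\<^sup>2 * J"
    unfolding t' using \<theta> by (simp add: field_simps power2_eq_square)
  then have "ennreal A \<le> ennreal (4 * K\<^sub>1 * K\<^sub>2 * b powr n * m / \<theta>\<^sup>2) * ennreal J"
    using \<theta> K_pos m by (simp add: ennreal_leI flip: ennreal_mult')
  then show ?thesis using A J unfolding E_def I_def by simp
qed

text \<open>Points near a unit ball that carries large mass are controlled by the mass of balls of
  radius 2: around a heavy point, a whole unit ball of points is heavy at that scale.\<close>

lemma emeasure_neighbourhood_of_heavy_points:
  fixes s :: ennreal
  assumes u [measurable]: "u \<in> borel_measurable M" and n: "1 \<le> n"
  defines "H \<equiv> (\<Union>y\<in>{y. s \<le> (\<integral>\<^sup>+x\<in>ball y 1. u x \<partial>M)}. ball y n)"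
  shows "H \<in> sets M" and "ennreal c * emeasure M H \<le> ennreal (C * b powr (n + 1)) * emeasure M {y. s \<le> (\<integral>\<^sup>+x\<in>ball y 2. u x \<partial>M)}"
proof -
  have "open H" unfolding H_def by auto
  then show H [measurable]: "H \<in> sets M" by simp
  define N where "N = {y. s \<le> (\<integral>\<^sup>+x\<in>ball y 2. u x \<partial>M)}"
  have [measurable]: "(\<lambda>y. \<integral>\<^sup>+x\<in>ball y 2. u x \<partial>M) \<in> borel_measurable M"
    by (rule borel_measurable_ball_integral[OF sets_M u])
  have "{y \<in> space M. s \<le> (\<integral>\<^sup>+x\<in>ball y 2. u x \<partial>M)} \<in> sets M" by measurable
  then have N [measurable]: "N \<in> sets M" by (simp add: N_def)
  have "ennreal c * emeasure M H = (\<integral>\<^sup>+x. ennreal c * indicator H x \<partial>M)"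
    by (rule nn_integral_cmult_indicator[symmetric]) measurable
  also have "\<dots> \<le> (\<integral>\<^sup>+x. (\<integral>\<^sup>+y\<in>ball x (n + 1). indicator N y \<partial>M) \<partial>M)"
  proof (intro nn_integral_mono)
    fix x
    show "ennreal c * indicator H x \<le> (\<integral>\<^sup>+y\<in>ball x (n + 1). indicator N y \<partial>M)"
    proof (cases "x \<in> H")
      case True
      then obtain y where y: "s \<le> (\<integral>\<^sup>+x\<in>ball y 1. u x \<partial>M)" "dist y x < n" by (auto simp: H_def)
      have "ennreal c \<le> ennreal (c * a powr 1)"
        using c_pos one_less_a by (intro ennreal_leI) simp
      also have "\<dots> \<le> emeasure M (ball y 1)" by (rule ball_lower) simp
      also have "\<dots> = (\<integral>\<^sup>+w. indicator (ball y 1) w \<partial>M)" by simp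
      also have "\<dots> \<le> (\<integral>\<^sup>+y\<in>ball x (n + 1). indicator N y \<partial>M)"
      proof (intro nn_integral_mono)
        fix w
        show "indicator (ball y 1) w \<le> (indicator N w * indicator (ball x (n + 1)) w :: ennreal)"
        proof (cases "w \<in> ball y 1")
          case True
          have "s \<le> (\<integral>\<^sup>+x\<in>ball w 2. u x \<partial>M)"
          proof (rule order_trans[OF y(1)], intro nn_integral_mono)
            fix v
            show "u v * indicator (ball y 1) v \<le> u v * indicator (ball w 2) v"
              using True dist_triangle[of w v y] by (auto simp: dist_commute split: split_indicator)
          qed
          moreover have "dist x w < n + 1" using True y(2) dist_triangle[of x w y] by (simp add: dist_commute)
          ultimately show ?thesis by (auto simp: N_def split: split_indicator)
        qed simp
      qed
      finally show ?thesis using True by simp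
    qed simp
  qed
  also have "\<dots> \<le> ennreal (C * b powr (n + 1)) * (\<integral>\<^sup>+y. indicator N y \<partial>M)"
    using n by (intro nn_integral_ball_integral_le) auto
  finally show "ennreal c * emeasure M H \<le> ennreal (C * b powr (n + 1)) * emeasure M {y. s \<le> (\<integral>\<^sup>+x\<in>ball y 2. u x \<partial>M)}"
    unfolding N_def[symmetric] nn_integral_indicator[OF N] .
qed

end

section \<open>Heavy unit balls\<close>

lemma suminf_le_if_partial_sums_le:
  "(\<And>N. (\<Sum>i<N. f i) \<le> B) \<Longrightarrow> (\<Sum>i. f i) \<le> (B :: ennreal)"
  by (simp add: suminf_eq_SUP SUP_least)

lemma sum_power_diff_le:
  fixes q :: real
  assumes "0 < q" "q < 1"
  shows "(\<Sum>k<n. q ^ (n - k)) \<le> 1 / (1 - q)"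
proof -
  have "(\<Sum>k<n. q ^ (n - k)) = (\<Sum>k<n. q ^ Suc (n - Suc k))"
    by (intro sum.cong) (auto simp: Suc_diff_Suc)
  also have "\<dots> = (\<Sum>k<n. q ^ Suc k)"
    by (rule sum.nat_diff_reindex)
  also have "\<dots> = q * (1 - q ^ n) / (1 - q)"
    using assms by (simp add: sum_distrib_left[symmetric] sum_gp_strict)
  also have "\<dots> \<le> 1 / (1 - q)"
    using assms by (intro divide_right_mono mult_le_one) (auto simp: power_le_one)
  finally show ?thesis .
qed

lemma sum_truncated_geometric_le:
  fixes q :: real
  assumes "0 < q" "q < 1"
  shows "(\<Sum>i<N. if k < Suc i then q ^ (Suc i - k) else 0) \<le> 1 / (1 - q)"
proof -
  have "(\<Sum>i<N. if k < Suc i then q ^ (Suc i - k) else 0) \<le> (1 - q ^ (N - k)) / (1 - q)"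
  proof (induction N)
    case (Suc N)
    show ?case
    proof (cases "k \<le> N")
      case True
      have "(\<Sum>i<Suc N. if k < Suc i then q ^ (Suc i - k) else 0) \<le> (1 - q ^ (N - k)) / (1 - q) + q ^ Suc (N - k)"
        using Suc True by (simp add: Suc_diff_le)
      also have "\<dots> \<le> (1 - q ^ (N - k)) / (1 - q) + q ^ (N - k)"
        using assms by (simp add: mult_left_le_one_le)
      also have "\<dots> = (1 - q ^ (Suc N - k)) / (1 - q)"
        using assms True by (simp add: Suc_diff_le field_simps)
      finally show ?thesis .
    qed (use Suc in auto)
  qed simp
  also have "\<dots> \<le> 1 / (1 - q)"
    using assms by (intro divide_right_mono) auto
  finally show ?thesis .
qed

context pinched_hyperbolic_space
begin

lemma tau_ge_1: "1 \<le> \<tau>"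
  using one_less_a a_le_b by (simp add: tau_eq)

lemma a_powr_tau: "a powr \<tau> = b"
  using one_less_a one_less_b by (simp add: tau_eq)

lemma power_a_powr_tau: "(a ^ n) powr \<tau> = b ^ n"
proof -
  have "(a ^ n) powr \<tau> = (a powr \<tau>) powr real n"
    using one_less_a by (simp add: powr_powr mult.commute flip: powr_realpow)
  then show ?thesis using one_less_b by (simp add: a_powr_tau powr_realpow)
qed

text \<open>Jensen's inequality on a ball, with a superfluous factor \<open>2 powr \<tau>\<close>: for \<open>s > 0\<close> one has
  \<open>v \<le> s powr (1 - \<tau>) * v powr \<tau> + s\<close>, and \<open>s\<close> is chosen so that the second term contributes
  half of the integral at most.\<close>

lemma ball_integral_powr_le:
  assumes [measurable]: "f \<in> borel_measurable M" and f0: "\<And>x. 0 \<le> f x" and r: "1 \<le> r"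
    and fin: "(\<integral>\<^sup>+x\<in>ball y r. ennreal (f x) \<partial>M) < \<infinity>"
  shows "ennreal (enn2real (\<integral>\<^sup>+x\<in>ball y r. ennreal (f x) \<partial>M) powr \<tau>)
    \<le> ennreal (2 powr \<tau> * (C * b powr r) powr (\<tau> - 1)) * (\<integral>\<^sup>+x\<in>ball y r. ennreal (f x powr \<tau>) \<partial>M)"
proof -
  define V where "V = C * b powr r"
  have V: "0 < V" using C_pos one_less_b by (simp add: V_def)
  obtain w where w: "(\<integral>\<^sup>+x\<in>ball y r. ennreal (f x) \<partial>M) = ennreal w" "0 \<le> w"
    using fin by (cases "\<integral>\<^sup>+x\<in>ball y r. ennreal (f x) \<partial>M") auto
  define G where "G = (\<integral>\<^sup>+x\<in>ball y r. ennreal (f x powr \<tau>) \<partial>M)"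
  have "ennreal (w powr \<tau>) \<le> ennreal (2 powr \<tau> * V powr (\<tau> - 1)) * G"
  proof (cases "w = 0")
    case False
    then have w0: "0 < w" using w by simp
    define s where "s = w / (2 * V)"
    have s: "0 < s" using w0 V by (simp add: s_def)
    have young: "v \<le> s powr (1 - \<tau>) * v powr \<tau> + s" if "0 \<le> v" for v
    proof (cases "v \<le> s")
      case True
      then show ?thesis by (simp add: add_increasing)
    next
      case False
      have "v = v powr (1 - \<tau>) * v powr \<tau>"
        using False s by (simp flip: powr_add)
      also have "\<dots> \<le> s powr (1 - \<tau>) * v powr \<tau>"
        using False s tau_ge_1 by (intro mult_right_mono powr_mono2') auto
      finally show ?thesis using s by simp
    qed
    have "ennreal w \<le> (\<integral>\<^sup>+x. ennreal (s powr (1 - \<tau>)) * (ennreal (f x powr \<tau>) * indicator (ball y r) x)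
        + ennreal s * indicator (ball y r) x \<partial>M)"
      unfolding w(1)[symmetric]
    proof (intro nn_integral_mono)
      fix x
      have "ennreal (f x) \<le> ennreal (s powr (1 - \<tau>)) * ennreal (f x powr \<tau>) + ennreal s"
        using young[OF f0[of x]] s by (simp add: ennreal_leI flip: ennreal_mult ennreal_plus)
      then show "ennreal (f x) * indicator (ball y r) x \<le> ennreal (s powr (1 - \<tau>)) * (ennreal (f x powr \<tau>) * indicator (ball y r) x)
        + ennreal s * indicator (ball y r) x"
        by (simp split: split_indicator)
    qed
    also have "\<dots> = ennreal (s powr (1 - \<tau>)) * G + ennreal s * emeasure M (ball y r)"
      unfolding G_def by (subst nn_integral_add) (simp_all add: nn_integral_cmult nn_integral_cmult_indicator)
    also have "\<dots> \<le> ennreal (s powr (1 - \<tau>)) * G + ennreal s * ennreal V"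
      unfolding V_def by (intro add_left_mono mult_left_mono ball_upper r) simp
    also have "ennreal s * ennreal V = ennreal (w / 2)"
      using s V by (simp add: s_def flip: ennreal_mult)
    finally have *: "ennreal w \<le> ennreal (s powr (1 - \<tau>)) * G + ennreal (w / 2)" .
    show ?thesis
    proof (cases G)
      case (real G')
      then have "ennreal w \<le> ennreal (s powr (1 - \<tau>) * G' + w / 2)"
        using * w0 by (simp add: ennreal_mult)
      then have "w \<le> s powr (1 - \<tau>) * G' + w / 2"
        using real w0 by (subst (asm) ennreal_le_iff) auto
      then have "w / 2 * s powr (\<tau> - 1) \<le> s powr (1 - \<tau>) * G' * s powr (\<tau> - 1)"
        by (intro mult_right_mono) auto
      also have "\<dots> = G' * s powr ((1 - \<tau>) + (\<tau> - 1))"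
        by (simp only: powr_add mult_ac)
      also have "\<dots> = G'" using s by simp
      finally have le: "w / 2 * s powr (\<tau> - 1) \<le> G'" .
      have "w powr \<tau> = 2 powr \<tau> * V powr (\<tau> - 1) * (w / 2 * s powr (\<tau> - 1))"
      proof -
        have "w / 2 * s powr (\<tau> - 1) = (w / 2) powr 1 * ((w / 2) powr (\<tau> - 1) / V powr (\<tau> - 1))"
          using w0 V by (simp add: s_def powr_divide powr_mult)
        also have "\<dots> = (w / 2) powr (1 + (\<tau> - 1)) / V powr (\<tau> - 1)"
          by (simp only: powr_add times_divide_eq_right)
        finally show ?thesis using w0 V by (simp add: powr_divide)
      qed
      also have "\<dots> \<le> 2 powr \<tau> * V powr (\<tau> - 1) * G'"
        using le by (intro mult_left_mono) auto
      finally show ?thesis using real by (simp add: ennreal_leI flip: ennreal_mult)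
    next
      case top
      then show ?thesis using V by (simp add: ennreal_mult_top)
    qed
  qed simp
  then show ?thesis using w by (simp add: V_def G_def)
qed

lemma nn_integral_ball_integral_powr_le:
  assumes [measurable]: "f \<in> borel_measurable M" and f0: "\<And>x. 0 \<le> f x" and r: "1 \<le> r"
    and fin: "(\<integral>\<^sup>+x. ennreal (f x) \<partial>M) < \<infinity>"
  shows "(\<integral>\<^sup>+y. ennreal (enn2real (\<integral>\<^sup>+x\<in>ball y r. ennreal (f x) \<partial>M) powr \<tau>) \<partial>M)
    \<le> ennreal ((2 * C * b powr r) powr \<tau>) * (\<integral>\<^sup>+x. ennreal (f x powr \<tau>) \<partial>M)"
proof -
  define V where "V = C * b powr r"
  have V: "0 < V" using C_pos one_less_b by (simp add: V_def)
  have [measurable]: "(\<lambda>y. \<integral>\<^sup>+x\<in>ball y r. ennreal (f x powr \<tau>) \<partial>M) \<in> borel_measurable M"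
    by (rule borel_measurable_ball_integral) simp_all
  have fin': "(\<integral>\<^sup>+x\<in>ball y r. ennreal (f x) \<partial>M) < \<infinity>" for y
  proof (rule order_le_less_trans[OF _ fin])
    show "(\<integral>\<^sup>+x\<in>ball y r. ennreal (f x) \<partial>M) \<le> (\<integral>\<^sup>+x. ennreal (f x) \<partial>M)"
      by (intro nn_integral_mono) (simp split: split_indicator)
  qed
  have "(\<integral>\<^sup>+y. ennreal (enn2real (\<integral>\<^sup>+x\<in>ball y r. ennreal (f x) \<partial>M) powr \<tau>) \<partial>M)
     \<le> (\<integral>\<^sup>+y. ennreal (2 powr \<tau> * V powr (\<tau> - 1)) * (\<integral>\<^sup>+x\<in>ball y r. ennreal (f x powr \<tau>) \<partial>M) \<partial>M)"
    unfolding V_def by (intro nn_integral_mono ball_integral_powr_le f0 r fin') simp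
  also have "\<dots> = ennreal (2 powr \<tau> * V powr (\<tau> - 1)) * (\<integral>\<^sup>+y. (\<integral>\<^sup>+x\<in>ball y r. ennreal (f x powr \<tau>) \<partial>M) \<partial>M)"
    by (rule nn_integral_cmult) measurable
  also have "\<dots> \<le> ennreal (2 powr \<tau> * V powr (\<tau> - 1)) * (ennreal V * (\<integral>\<^sup>+x. ennreal (f x powr \<tau>) \<partial>M))"
    unfolding V_def by (intro mult_left_mono nn_integral_ball_integral_le r) simp_all
  also have "\<dots> = ennreal (2 powr \<tau> * (V powr (\<tau> - 1) * V powr 1)) * (\<integral>\<^sup>+x. ennreal (f x powr \<tau>) \<partial>M)"
    using V by (simp add: ennreal_mult mult.assoc)
  also have "2 powr \<tau> * (V powr (\<tau> - 1) * V powr 1) = (2 * C * b powr r) powr \<tau>"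
  proof -
    have "2 * C * b powr r = 2 * V" by (simp add: V_def)
    moreover have "V powr (\<tau> - 1) * V powr 1 = V powr \<tau>" by (subst powr_add[symmetric]) simp
    ultimately show ?thesis using V by (simp only: powr_mult)
  qed
  finally show ?thesis .
qed

text \<open>A geometric sum dominated by its last term, which is at most \<open>w powr \<tau>\<close>
  because \<open>b ^ n = (a ^ n) powr \<tau>\<close>.\<close>

lemma sum_power_b_le_powr_tau:
  assumes "0 \<le> w"
  shows "(\<Sum>i<N. if a ^ Suc i \<le> w then b ^ Suc i else 0) \<le> b / (b - 1) * w powr \<tau>"
proof -
  have "(\<Sum>i<N. if a ^ Suc i \<le> w then b ^ Suc i else 0) \<le> b / (b - 1) * min (b ^ N) (w powr \<tau>)"
  proof (induction N)
    case 0
    then show ?case using one_less_b by (simp add: divide_nonneg_nonneg)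
  next
    case (Suc N)
    have b: "0 \<le> b / (b - 1)" using one_less_b by simp
    show ?case
    proof (cases "a ^ Suc N \<le> w")
      case True
      have "(a ^ Suc N) powr \<tau> \<le> w powr \<tau>"
        using True one_less_a tau_ge_1 by (intro powr_mono2) auto
      then have le: "b ^ Suc N \<le> w powr \<tau>" by (simp only: power_a_powr_tau)
      have "(\<Sum>i<Suc N. if a ^ Suc i \<le> w then b ^ Suc i else 0) \<le> b / (b - 1) * b ^ N + b ^ Suc N"
        using Suc True mult_left_mono[OF min.cobounded1 b, of "b ^ N" "w powr \<tau>"] by simp
      also have "\<dots> = b / (b - 1) * b ^ Suc N"
        using one_less_b by (simp add: field_simps)
      finally show ?thesis using le by (simp add: min_absorb1)
    next
      case False
      have "min (b ^ N) (w powr \<tau>) \<le> min (b ^ Suc N) (w powr \<tau>)"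
        using one_less_b by (intro min.mono power_increasing) auto
      then have "b / (b - 1) * min (b ^ N) (w powr \<tau>) \<le> b / (b - 1) * min (b ^ Suc N) (w powr \<tau>)"
        using b by (rule mult_left_mono)
      moreover have "(\<Sum>i<Suc N. if a ^ Suc i \<le> w then b ^ Suc i else 0)
          = (\<Sum>i<N. if a ^ Suc i \<le> w then b ^ Suc i else 0)"
        using False by (simp del: power_Suc)
      ultimately show ?thesis using Suc.IH by linarith
    qed
  qed
  also have "\<dots> \<le> b / (b - 1) * w powr \<tau>"
    using one_less_b by (intro mult_left_mono) auto
  finally show ?thesis .
qed

text \<open>The \<open>n\<close>-neighbourhoods of the centres of unit balls of mass at least \<open>a ^ n\<close>, summed over
  \<open>n = Suc i\<close>.\<close>

lemma sum_neighbourhoods_of_heavy_points: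
  assumes [measurable]: "f \<in> borel_measurable M" and f0: "\<And>x. 0 \<le> f x"
    and fin: "(\<integral>\<^sup>+x. ennreal (f x) \<partial>M) < \<infinity>"
  shows "(\<Sum>i. emeasure M (\<Union>y\<in>{y. ennreal (a ^ Suc i) \<le> (\<integral>\<^sup>+x\<in>ball y 1. ennreal (f x) \<partial>M)}. ball y (real (Suc i))))
    \<le> ennreal (C / c * b * (b / (b - 1)) * (2 * C * b powr 2) powr \<tau>) * (\<integral>\<^sup>+x. ennreal (f x powr \<tau>) \<partial>M)"
proof -
  define W where "W y = (\<integral>\<^sup>+x\<in>ball y 2. ennreal (f x) \<partial>M)" for y
  define w where "w y = enn2real (W y)" for y
  have [measurable]: "W \<in> borel_measurable M"
    unfolding W_def by (rule borel_measurable_ball_integral) simp_all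
  have Ww: "W y = ennreal (w y)" for y
  proof -
    have "W y \<le> (\<integral>\<^sup>+x. ennreal (f x) \<partial>M)"
      unfolding W_def by (intro nn_integral_mono) (simp split: split_indicator)
    then show ?thesis using fin by (simp add: w_def ennreal_enn2real order_le_less_trans)
  qed
  have w0: "0 \<le> w y" for y by (simp add: w_def)
  have [measurable]: "w \<in> borel_measurable M" unfolding w_def by measurable
  have "emeasure M (\<Union>y\<in>{y. ennreal (a ^ Suc i) \<le> (\<integral>\<^sup>+x\<in>ball y 1. ennreal (f x) \<partial>M)}. ball y (real (Suc i)))
    \<le> ennreal (C / c * b) * (\<integral>\<^sup>+y. ennreal (if a ^ Suc i \<le> w y then b ^ Suc i else 0) \<partial>M)" (is "?e \<le> _") for i
  proof -
    have "ennreal c * ?e \<le> ennreal (C * b powr (real (Suc i) + 1)) * emeasure M {y. ennreal (a ^ Suc i) \<le> W y}"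
      unfolding W_def by (rule emeasure_neighbourhood_of_heavy_points) simp_all
    also have "\<dots> = ennreal (C * b * b ^ Suc i) * emeasure M {y. a ^ Suc i \<le> w y}"
    proof -
      have "b powr (real (Suc i) + 1) = b ^ Suc i * b"
        using one_less_b powr_realpow[of b "Suc i"] powr_add[of b "real (Suc i)" 1]
        by (simp del: of_nat_Suc power_Suc)
      then show ?thesis
        by (simp only: Ww ennreal_le_iff[OF w0] mult_ac)
    qed
    also have "\<dots> = ennreal (C * b) * (ennreal (b ^ Suc i) * (\<integral>\<^sup>+y. indicator {y\<in>space M. a ^ Suc i \<le> w y} y \<partial>M))"
      using one_less_b C_pos by (subst nn_integral_indicator) (simp_all add: ennreal_mult mult.assoc del: power_Suc)
    also have "\<dots> = ennreal (C * b) * (\<integral>\<^sup>+y. ennreal (b ^ Suc i) * indicator {y\<in>space M. a ^ Suc i \<le> w y} y \<partial>M)"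
      by (subst nn_integral_cmult) (simp_all del: power_Suc)
    also have "\<dots> = ennreal (C * b) * (\<integral>\<^sup>+y. ennreal (if a ^ Suc i \<le> w y then b ^ Suc i else 0) \<partial>M)"
      by (intro arg_cong2[of _ _ _ _ "(*)"] nn_integral_cong refl) (auto split: split_indicator)
    also have "ennreal (C * b) = ennreal c * ennreal (C / c * b)"
      using c_pos C_pos one_less_b by (simp flip: ennreal_mult)
    finally show ?thesis
      using c_pos by (simp add: mult.assoc ennreal_mult_le_mult_iff)
  qed
  then have "(\<Sum>i. emeasure M (\<Union>y\<in>{y. ennreal (a ^ Suc i) \<le> (\<integral>\<^sup>+x\<in>ball y 1. ennreal (f x) \<partial>M)}. ball y (real (Suc i))))
    \<le> (\<Sum>i. ennreal (C / c * b) * (\<integral>\<^sup>+y. ennreal (if a ^ Suc i \<le> w y then b ^ Suc i else 0) \<partial>M))"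
    by (intro suminf_le) simp_all
  also have "\<dots> = ennreal (C / c * b) * (\<integral>\<^sup>+y. (\<Sum>i. ennreal (if a ^ Suc i \<le> w y then b ^ Suc i else 0)) \<partial>M)"
    by (subst nn_integral_suminf) simp_all
  also have "\<dots> \<le> ennreal (C / c * b) * (\<integral>\<^sup>+y. ennreal (b / (b - 1)) * ennreal (w y powr \<tau>) \<partial>M)"
  proof (intro mult_left_mono nn_integral_mono suminf_le_if_partial_sums_le)
    fix y N
    have "(\<Sum>i<N. ennreal (if a ^ Suc i \<le> w y then b ^ Suc i else 0)) = ennreal (\<Sum>i<N. if a ^ Suc i \<le> w y then b ^ Suc i else 0)"
      using one_less_b by (intro sum_ennreal) simp
    also have "\<dots> \<le> ennreal (b / (b - 1) * w y powr \<tau>)"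
      by (intro ennreal_leI sum_power_b_le_powr_tau w0)
    also have "\<dots> = ennreal (b / (b - 1)) * ennreal (w y powr \<tau>)"
      using one_less_b by (intro ennreal_mult) simp_all
    finally show "(\<Sum>i<N. ennreal (if a ^ Suc i \<le> w y then b ^ Suc i else 0)) \<le> \<dots>" .
  qed simp
  also have "\<dots> = ennreal (C / c * b) * (ennreal (b / (b - 1)) * (\<integral>\<^sup>+y. ennreal (w y powr \<tau>) \<partial>M))"
    by (subst nn_integral_cmult) simp_all
  also have "\<dots> \<le> ennreal (C / c * b) * (ennreal (b / (b - 1)) * (ennreal ((2 * C * b powr 2) powr \<tau>) * (\<integral>\<^sup>+x. ennreal (f x powr \<tau>) \<partial>M)))"
    unfolding w_def W_def by (intro mult_left_mono nn_integral_ball_integral_powr_le f0 fin) simp_all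
  also have "\<dots> = ennreal (C / c * b * (b / (b - 1)) * (2 * C * b powr 2) powr \<tau>) * (\<integral>\<^sup>+x. ennreal (f x powr \<tau>) \<partial>M)"
  proof -
    have "ennreal (C / c * b * (b / (b - 1)) * (2 * C * b powr 2) powr \<tau>)
      = ennreal (C / c * b) * ennreal (b / (b - 1)) * ennreal ((2 * C * b powr 2) powr \<tau>)"
      using C_pos c_pos one_less_b by (subst ennreal_mult, simp, simp, subst ennreal_mult) simp_all
    then show ?thesis by (simp only: mult.assoc)
  qed
  finally show ?thesis .
qed

end

section \<open>Decomposition by the mass of unit balls\<close>

context pinched_hyperbolic_space
begin

text \<open>The ratio of the geometric series below. The levels are weighted by powers of \<open>sqrt \<rho>\<close>, which
  costs a factor \<open>\<rho>\<close> per level in the weak type estimate and leaves \<open>b / a\<^sup>2 / \<rho> = \<rho>\<close>.\<close>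

definition \<rho> :: real where "\<rho> = sqrt b / a"

lemma rho: "0 < \<rho>" "\<rho> < 1" "b = \<rho> * \<rho> * a * a"
proof -
  have "sqrt b < sqrt (a\<^sup>2)" using b_less_a_squared by (intro real_sqrt_less_mono)
  then have "sqrt b < a" using one_less_a by simp
  then show "\<rho> < 1" using one_less_a by (simp add: \<rho>_def)
  show "0 < \<rho>" using one_less_a one_less_b by (simp add: \<rho>_def)
  have "\<rho> * \<rho> * a * a = sqrt b * sqrt b" using one_less_a by (simp add: \<rho>_def)
  also have "\<dots> = b" using one_less_b by simp
  finally show "b = \<rho> * \<rho> * a * a" by simp
qed

text \<open>The integral of \<open>f\<close> over the unit ball with centre \<open>y\<close>, as a real number; it is meaningful for
  integrable \<open>f\<close>.\<close>

definition unit_ball_mass :: "('a \<Rightarrow> real) \<Rightarrow> 'a \<Rightarrow> real" where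
  "unit_ball_mass f y = enn2real (\<integral>\<^sup>+x\<in>ball y 1. ennreal (f x) \<partial>M)"

text \<open>The number \<open>k\<close> such that the mass of the unit ball lies between \<open>a ^ k\<close> and \<open>a ^ Suc k\<close>.
  All masses less than \<open>a\<close> are put in level 0: they need no finer splitting because the nonzero
  values of the functions considered are at least 1.\<close>

definition mass_level :: "('a \<Rightarrow> real) \<Rightarrow> 'a \<Rightarrow> nat" where
  "mass_level f y = nat \<lfloor>log a (max 1 (unit_ball_mass f y))\<rfloor>"

lemma mass_level_bounds:
  "a ^ mass_level f y \<le> max 1 (unit_ball_mass f y)" "unit_ball_mass f y < a ^ Suc (mass_level f y)"
proof -
  define w where "w = max 1 (unit_ball_mass f y)"
  have w: "1 \<le> w" by (simp add: w_def)
  have l: "0 \<le> log a w" using w one_less_a by simp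
  have m: "real (mass_level f y) = of_int \<lfloor>log a w\<rfloor>"
    using l by (simp add: mass_level_def w_def)
  have "a powr real (mass_level f y) \<le> a powr log a w"
    using one_less_a unfolding m by (intro powr_mono) auto
  then show "a ^ mass_level f y \<le> max 1 (unit_ball_mass f y)"
    using w one_less_a by (simp add: powr_realpow w_def[symmetric])
  have "a powr log a w < a powr (real (mass_level f y) + 1)"
    using one_less_a unfolding m by (intro powr_less_mono) linarith+
  then have "w < a ^ Suc (mass_level f y)"
    using w one_less_a by (simp add: powr_add powr_realpow mult.commute)
  then show "unit_ball_mass f y < a ^ Suc (mass_level f y)" by (simp add: w_def)
qed

lemma borel_measurable_unit_ball_mass [measurable]:
  assumes [measurable]: "f \<in> borel_measurable M"
  shows "unit_ball_mass f \<in> borel_measurable M"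
proof -
  have [measurable]: "(\<lambda>y. \<integral>\<^sup>+x\<in>ball y 1. ennreal (f x) \<partial>M) \<in> borel_measurable M"
    by (rule borel_measurable_ball_integral) simp_all
  show ?thesis unfolding unit_ball_mass_def[abs_def] by measurable
qed

lemma measurable_mass_level [measurable]:
  assumes [measurable]: "f \<in> borel_measurable M"
  shows "mass_level f \<in> measurable M (count_space UNIV)"
  unfolding mass_level_def[abs_def] by measurable

lemma unit_ball_mass_eq:
  assumes "(\<integral>\<^sup>+x. ennreal (f x) \<partial>M) < \<infinity>"
  shows "ennreal (unit_ball_mass f y) = (\<integral>\<^sup>+x\<in>ball y 1. ennreal (f x) \<partial>M)"
proof -
  have "(\<integral>\<^sup>+x\<in>ball y 1. ennreal (f x) \<partial>M) \<le> (\<integral>\<^sup>+x. ennreal (f x) \<partial>M)"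
    by (intro nn_integral_mono) (simp split: split_indicator)
  then show ?thesis using assms by (simp add: unit_ball_mass_def ennreal_enn2real order_le_less_trans)
qed

text \<open>The restriction of \<open>f\<close> to the points of level \<open>k\<close>, extended by zero.\<close>

definition level_part :: "('a \<Rightarrow> real) \<Rightarrow> nat \<Rightarrow> 'a \<Rightarrow> ennreal" where
  "level_part f k y = ennreal (f y) * indicator {y. mass_level f y = k} y"

lemma borel_measurable_level_part [measurable]:
  assumes [measurable]: "f \<in> borel_measurable M"
  shows "level_part f k \<in> borel_measurable M"
proof -
  have "{y \<in> space M. mass_level f y = k} \<in> sets M" by measurable
  then have [measurable]: "{y. mass_level f y = k} \<in> sets M" by simp
  show ?thesis unfolding level_part_def[abs_def] by measurable
qed

lemma level_part_weak_type:
  assumes [measurable]: "f \<in> borel_measurable M" and fin: "(\<integral>\<^sup>+x. ennreal (f x) \<partial>M) < \<infinity>"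
    and c2: "0 < c2" and k: "k < Suc i"
  shows "emeasure M {x. ennreal (c2 * a ^ Suc i * sqrt \<rho> ^ (Suc i - k)) < (\<integral>\<^sup>+y\<in>ball x (Suc i). level_part f k y \<partial>M)}
    \<le> ennreal (4 * K\<^sub>1 * K\<^sub>2 * a / c2\<^sup>2 * ((b / a) ^ k * \<rho> ^ (Suc i - k))) * (\<integral>\<^sup>+y. level_part f k y \<partial>M)"
proof -
  define j where "j = Suc i - k"
  have n: "Suc i = k + j" using k by (simp add: j_def)
  define \<theta> where "\<theta> = c2 * a ^ Suc i * sqrt \<rho> ^ j"
  have \<theta>: "0 < \<theta>" using c2 one_less_a rho by (simp add: \<theta>_def)
  have le: "level_part f k y \<le> ennreal (f y)" for y by (simp add: level_part_def split: split_indicator)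
  have "emeasure M {x. ennreal \<theta> < (\<integral>\<^sup>+y\<in>ball x (Suc i). level_part f k y \<partial>M)}
    \<le> ennreal (4 * K\<^sub>1 * K\<^sub>2 * b powr (Suc i) * a ^ Suc k / \<theta>\<^sup>2) * (\<integral>\<^sup>+y. level_part f k y \<partial>M)"
  proof (rule ball_integral_weak_type_if_unit_balls_light)
    fix y assume "level_part f k y \<noteq> 0"
    then have y: "mass_level f y = k" by (auto simp: level_part_def split: split_indicator_asm)
    have "(\<integral>\<^sup>+x\<in>ball y 1. level_part f k x \<partial>M) \<le> (\<integral>\<^sup>+x\<in>ball y 1. ennreal (f x) \<partial>M)"
      using le by (intro nn_integral_mono mult_right_mono) auto
    also have "\<dots> = ennreal (unit_ball_mass f y)" by (rule unit_ball_mass_eq[OF fin, symmetric])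
    also have "\<dots> \<le> ennreal (a ^ Suc k)"
      using mass_level_bounds(2)[of f y] y by (intro ennreal_leI) simp
    finally show "(\<integral>\<^sup>+x\<in>ball y 1. level_part f k x \<partial>M) \<le> ennreal (a ^ Suc k)" .
  next
    show "(\<integral>\<^sup>+y. level_part f k y \<partial>M) < \<infinity>"
      using le by (intro order_le_less_trans[OF nn_integral_mono fin]) simp
  qed (use one_less_a \<theta> in auto)
  also have "4 * K\<^sub>1 * K\<^sub>2 * b powr (Suc i) * a ^ Suc k / \<theta>\<^sup>2 = 4 * K\<^sub>1 * K\<^sub>2 * a / c2\<^sup>2 * ((b / a) ^ k * \<rho> ^ j)"
  proof -
    have "(sqrt \<rho> ^ j)\<^sup>2 = \<rho> ^ j"
      using rho by (simp flip: power_mult add: mult.commute[of j] power_mult)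
    moreover have "b powr (Suc i) = b ^ k * (\<rho> ^ j * \<rho> ^ j * a ^ j * a ^ j)"
    proof -
      have "b ^ j = \<rho> ^ j * \<rho> ^ j * a ^ j * a ^ j"
        by (subst rho(3)) (simp add: power_mult_distrib)
      then show ?thesis using one_less_b powr_realpow[of b "Suc i"] by (simp only: n power_add)
    qed
    moreover have "\<theta>\<^sup>2 = c2\<^sup>2 * (a ^ k * a ^ j)\<^sup>2 * (sqrt \<rho> ^ j)\<^sup>2"
      unfolding \<theta>_def n by (simp add: power_mult_distrib power_add)
    ultimately show ?thesis
      using rho(1) one_less_a c2 by (simp add: power2_eq_square power_divide mult_ac)
  qed
  finally show ?thesis unfolding \<theta>_def j_def .
qed

text \<open>Exceptional sets of all levels \<open>k < n\<close>, summed over \<open>n = Suc i\<close>. The integrand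
  \<open>(b / a) ^ k * f y\<close> that remains is at most \<open>m powr \<tau>\<close>, where \<open>m\<close> is the larger of \<open>f y\<close> and the
  mass of the unit ball.\<close>

lemma sum_level_parts:
  assumes [measurable]: "f \<in> borel_measurable M" and f: "\<And>x. f x = 0 \<or> 1 \<le> f x"
    and fin: "(\<integral>\<^sup>+x. ennreal (f x) \<partial>M) < \<infinity>" and c2: "0 < c2"
  shows "(\<Sum>i. emeasure M (\<Union>k<Suc i. {x. ennreal (c2 * a ^ Suc i * sqrt \<rho> ^ (Suc i - k)) < (\<integral>\<^sup>+y\<in>ball x (Suc i). level_part f k y \<partial>M)}))
    \<le> ennreal (4 * K\<^sub>1 * K\<^sub>2 * a / c2\<^sup>2 / (1 - \<rho>)) *
      ((\<integral>\<^sup>+x. ennreal (f x powr \<tau>) \<partial>M) + (\<integral>\<^sup>+x. ennreal (unit_ball_mass f x powr \<tau>) \<partial>M))"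
proof -
  define K where "K = 4 * K\<^sub>1 * K\<^sub>2 * a / c2\<^sup>2"
  have K: "0 < K" using K_pos one_less_a c2 by (simp add: K_def)
  have f0: "0 \<le> f x" for x using f[of x] by auto
  let ?E = "\<lambda>i k. {x. ennreal (c2 * a ^ Suc i * sqrt \<rho> ^ (Suc i - k)) < (\<integral>\<^sup>+y\<in>ball x (Suc i). level_part f k y \<partial>M)}"
  have E: "?E i k \<in> sets M" for i k
    using ball_integral_lower_semicontinuous[OF sets_M borel_measurable_level_part] by simp
  define G where "G i y = (if mass_level f y < Suc i then \<rho> ^ (Suc i - mass_level f y) else 0)" for i y
  define h where "h y = K * ((b / a) ^ mass_level f y * f y)" for y
  have [measurable]: "h \<in> borel_measurable M" "G i \<in> borel_measurable M" for i
    unfolding h_def[abs_def] G_def[abs_def] by measurable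
  have h0: "0 \<le> h y" for y using K one_less_a one_less_b f0 by (simp add: h_def)
  have G0: "0 \<le> G i y" for i y using rho by (simp add: G_def)
  have "emeasure M (\<Union>k<Suc i. ?E i k) \<le> (\<integral>\<^sup>+y. ennreal (h y) * ennreal (G i y) \<partial>M)" for i
  proof -
    have "emeasure M (\<Union>k<Suc i. ?E i k) \<le> (\<Sum>k<Suc i. emeasure M (?E i k))"
      using E by (intro emeasure_subadditive_finite) auto
    also have "\<dots> \<le> (\<Sum>k<Suc i. ennreal (K * ((b / a) ^ k * \<rho> ^ (Suc i - k))) * (\<integral>\<^sup>+y. level_part f k y \<partial>M))"
      unfolding K_def by (intro sum_mono level_part_weak_type fin c2) auto
    also have "\<dots> = (\<integral>\<^sup>+y. (\<Sum>k<Suc i. ennreal (K * ((b / a) ^ k * \<rho> ^ (Suc i - k))) * level_part f k y) \<partial>M)"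
      by (subst nn_integral_sum) (simp_all add: nn_integral_cmult del: sum.lessThan_Suc)
    also have "\<dots> = (\<integral>\<^sup>+y. ennreal (h y) * ennreal (G i y) \<partial>M)"
    proof (intro nn_integral_cong)
      fix y
      have "(\<Sum>k<Suc i. ennreal (K * ((b / a) ^ k * \<rho> ^ (Suc i - k))) * level_part f k y)
        = (\<Sum>k<Suc i. if mass_level f y = k then ennreal (K * ((b / a) ^ k * \<rho> ^ (Suc i - k))) * ennreal (f y) else 0)"
        by (intro sum.cong) (auto simp: level_part_def)
      also have "\<dots> = (if mass_level f y < Suc i then ennreal (K * ((b / a) ^ mass_level f y * \<rho> ^ (Suc i - mass_level f y))) * ennreal (f y) else 0)"
        by (subst sum.delta') auto
      also have "\<dots> = ennreal (h y) * ennreal (G i y)"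
        using K rho one_less_a one_less_b f0[of y]
        by (simp add: h_def G_def mult_ac flip: ennreal_mult)
      finally show "(\<Sum>k<Suc i. ennreal (K * ((b / a) ^ k * \<rho> ^ (Suc i - k))) * level_part f k y) = \<dots>" .
    qed
    finally show ?thesis .
  qed
  then have "(\<Sum>i. emeasure M (\<Union>k<Suc i. ?E i k)) \<le> (\<Sum>i. \<integral>\<^sup>+y. ennreal (h y) * ennreal (G i y) \<partial>M)"
    by (intro suminf_le) simp_all
  also have "\<dots> = (\<integral>\<^sup>+y. ennreal (h y) * (\<Sum>i. ennreal (G i y)) \<partial>M)"
    by (subst nn_integral_suminf[symmetric]) simp_all
  also have "\<dots> \<le> (\<integral>\<^sup>+y. ennreal (K / (1 - \<rho>)) * (ennreal (f y powr \<tau>) + ennreal (unit_ball_mass f y powr \<tau>)) \<partial>M)"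
  proof (intro nn_integral_mono)
    fix y
    define w where "w = unit_ball_mass f y"
    have w0: "0 \<le> w" by (simp add: w_def unit_ball_mass_def)
    have "(\<Sum>i. ennreal (G i y)) \<le> ennreal (1 / (1 - \<rho>))"
    proof (rule suminf_le_if_partial_sums_le)
      fix N
      have "(\<Sum>i<N. ennreal (G i y)) = ennreal (\<Sum>i<N. G i y)" by (intro sum_ennreal G0)
      also have "\<dots> \<le> ennreal (1 / (1 - \<rho>))"
        unfolding G_def by (intro ennreal_leI sum_truncated_geometric_le rho)
      finally show "(\<Sum>i<N. ennreal (G i y)) \<le> ennreal (1 / (1 - \<rho>))" .
    qed
    then have "ennreal (h y) * (\<Sum>i. ennreal (G i y)) \<le> ennreal (h y) * ennreal (1 / (1 - \<rho>))"
      by (rule mult_left_mono) simp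
    also have "\<dots> = ennreal (K / (1 - \<rho>) * ((b / a) ^ mass_level f y * f y))"
      using h0 rho by (simp add: h_def flip: ennreal_mult)
    also have "\<dots> \<le> ennreal (K / (1 - \<rho>) * (f y powr \<tau> + w powr \<tau>))"
    proof (intro ennreal_leI mult_left_mono)
      show "(b / a) ^ mass_level f y * f y \<le> f y powr \<tau> + w powr \<tau>"
      proof (cases "f y = 0")
        case False
        then have f1: "1 \<le> f y" using f[of y] by simp
        define m where "m = max (f y) w"
        have m: "a ^ mass_level f y \<le> m" "f y \<le> m" "1 \<le> m"
          using mass_level_bounds(1)[of f y] f1 by (auto simp: m_def w_def)
        \<comment> \<open>\<open>b / a = a powr (\<tau> - 1)\<close>\<close>
        have "(b / a) ^ mass_level f y = (a ^ mass_level f y) powr (\<tau> - 1)"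
          using one_less_a by (simp add: powr_diff power_a_powr_tau power_divide)
        also have "\<dots> \<le> m powr (\<tau> - 1)"
          using m one_less_a tau_ge_1 by (intro powr_mono2) auto
        finally have "(b / a) ^ mass_level f y * f y \<le> m powr (\<tau> - 1) * m powr 1"
          using m f1 by (intro mult_mono) auto
        also have "\<dots> = m powr \<tau>" by (subst powr_add[symmetric]) simp
        also have "\<dots> \<le> f y powr \<tau> + w powr \<tau>" by (simp add: m_def max_def)
        finally show ?thesis .
      qed simp
    qed (use K rho in simp)
    also have "\<dots> = ennreal (K / (1 - \<rho>)) * (ennreal (f y powr \<tau>) + ennreal (w powr \<tau>))"
      using K rho by (subst ennreal_mult) simp_all
    finally show "ennreal (h y) * (\<Sum>i. ennreal (G i y)) \<le> ennreal (K / (1 - \<rho>)) * (ennreal (f y powr \<tau>) + ennreal (unit_ball_mass f y powr \<tau>))"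
      by (simp add: w_def)
  qed
  also have "\<dots> = ennreal (K / (1 - \<rho>)) * ((\<integral>\<^sup>+x. ennreal (f x powr \<tau>) \<partial>M) + (\<integral>\<^sup>+x. ennreal (unit_ball_mass f x powr \<tau>) \<partial>M))"
    by (subst nn_integral_cmult) (simp_all add: nn_integral_add)
  finally show ?thesis unfolding K_def .
qed

text \<open>A large average over \<open>ball x n\<close> comes either from a heavy unit ball near \<open>x\<close>, or from one
  of the levels below \<open>n\<close>.\<close>

lemma large_ball_integral_cases:
  assumes [measurable]: "f \<in> borel_measurable M" and f0: "\<And>x. 0 \<le> f x"
    and fin: "(\<integral>\<^sup>+x. ennreal (f x) \<partial>M) < \<infinity>" and c1: "0 < c1"
    and x: "ennreal (c1 * a ^ n) < (\<integral>\<^sup>+y\<in>ball x n. ennreal (f y) \<partial>M)"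
  shows "x \<in> (\<Union>y\<in>{y. ennreal (a ^ n) \<le> (\<integral>\<^sup>+x\<in>ball y 1. ennreal (f x) \<partial>M)}. ball y n)
    \<union> (\<Union>k<n. {x. ennreal (c1 * (1 - sqrt \<rho>) * a ^ n * sqrt \<rho> ^ (n - k)) < (\<integral>\<^sup>+y\<in>ball x n. level_part f k y \<partial>M)})"
proof (rule ccontr)
  assume nx: "\<not> ?thesis"
  have q: "0 < sqrt \<rho>" "sqrt \<rho> < 1" using rho by (auto simp: real_sqrt_lt_1_iff)
  have level: "mass_level f y < n" if y: "y \<in> ball x n" for y
  proof -
    have "\<not> ennreal (a ^ n) \<le> ennreal (unit_ball_mass f y)"
      using nx y unfolding unit_ball_mass_eq[OF fin] by (auto simp: dist_commute)
    then have w: "unit_ball_mass f y < a ^ n"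
      using ennreal_leI not_le_imp_less by blast
    have "n \<noteq> 0" using y by (auto intro: ccontr)
    then have "1 < a ^ n" using one_less_a by simp
    then have "a ^ mass_level f y < a ^ n" using mass_level_bounds(1)[of f y] w by simp
    then show ?thesis using one_less_a by (simp add: power_strict_increasing_iff)
  qed
  have "(\<integral>\<^sup>+y\<in>ball x n. ennreal (f y) \<partial>M) = (\<integral>\<^sup>+y. (\<Sum>k<n. level_part f k y * indicator (ball x n) y) \<partial>M)"
  proof (intro nn_integral_cong)
    fix y
    have "(\<Sum>k<n. level_part f k y) = (\<Sum>k<n. if mass_level f y = k then ennreal (f y) else 0)"
      by (intro sum.cong) (auto simp: level_part_def)
    also have "\<dots> = (if mass_level f y < n then ennreal (f y) else 0)"
      by (subst sum.delta') auto
    finally show "ennreal (f y) * indicator (ball x n) y = (\<Sum>k<n. level_part f k y * indicator (ball x n) y)"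
      using level[of y] by (simp add: sum_distrib_right[symmetric] split: split_indicator)
  qed
  also have "\<dots> = (\<Sum>k<n. \<integral>\<^sup>+y\<in>ball x n. level_part f k y \<partial>M)"
    by (rule nn_integral_sum) measurable
  also have "\<dots> \<le> (\<Sum>k<n. ennreal (c1 * (1 - sqrt \<rho>) * a ^ n * sqrt \<rho> ^ (n - k)))"
    using nx by (intro sum_mono) (auto simp: not_less)
  also have "\<dots> = ennreal (c1 * (1 - sqrt \<rho>) * a ^ n * (\<Sum>k<n. sqrt \<rho> ^ (n - k)))"
    using c1 q one_less_a by (subst sum_ennreal) (simp_all add: sum_distrib_left)
  also have "\<dots> \<le> ennreal (c1 * (1 - sqrt \<rho>) * a ^ n * (1 / (1 - sqrt \<rho>)))"
    using c1 q one_less_a by (intro ennreal_leI mult_left_mono sum_power_diff_le) simp_all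
  also have "\<dots> = ennreal (c1 * a ^ n)" using q by simp
  finally show False using x by simp
qed

lemma large_ball_weak_estimate:
  assumes c1: "0 < c1"
  obtains K where "0 < K" and "\<And>f. f \<in> borel_measurable M \<Longrightarrow> (\<And>x. f x = 0 \<or> 1 \<le> f x) \<Longrightarrow>
    emeasure M (\<Union>i. {x. ennreal (c1 * a ^ Suc i) < (\<integral>\<^sup>+y\<in>ball x (Suc i). ennreal (f y) \<partial>M)})
      \<le> ennreal K * (\<integral>\<^sup>+x. ennreal (f x powr \<tau>) \<partial>M)"
proof
  define c2 where "c2 = c1 * (1 - sqrt \<rho>)"
  have "sqrt \<rho> < 1" using rho by (simp add: real_sqrt_lt_1_iff)
  then have c2: "0 < c2" using c1 by (simp add: c2_def)
  define K\<^sub>h where "K\<^sub>h = C / c * b * (b / (b - 1)) * (2 * C * b powr 2) powr \<tau>"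
  define K\<^sub>l where "K\<^sub>l = 4 * K\<^sub>1 * K\<^sub>2 * a / c2\<^sup>2 / (1 - \<rho>)"
  define K\<^sub>j where "K\<^sub>j = (2 * C * b powr 1) powr \<tau>"
  have pos: "0 < K\<^sub>h" "0 < K\<^sub>l" "0 < K\<^sub>j"
    using C_pos c_pos one_less_b one_less_a rho c2 K_pos by (auto simp: K\<^sub>h_def K\<^sub>l_def K\<^sub>j_def)
  define K where "K = K\<^sub>h + K\<^sub>l * (1 + K\<^sub>j)"
  show "0 < K" using pos by (simp add: K_def add_pos_pos)
  fix f :: "'a \<Rightarrow> real" assume [measurable]: "f \<in> borel_measurable M" and f: "\<And>x. f x = 0 \<or> 1 \<le> f x"
  have f0: "0 \<le> f x" for x using f[of x] by auto
  define I where "I = (\<integral>\<^sup>+x. ennreal (f x powr \<tau>) \<partial>M)"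
  show "emeasure M (\<Union>i. {x. ennreal (c1 * a ^ Suc i) < (\<integral>\<^sup>+y\<in>ball x (Suc i). ennreal (f y) \<partial>M)})
      \<le> ennreal K * (\<integral>\<^sup>+x. ennreal (f x powr \<tau>) \<partial>M)"
  proof (cases "I = \<infinity>")
    case True
    then show ?thesis using \<open>0 < K\<close> by (simp add: I_def ennreal_mult_top)
  next
    case False
    have "(\<integral>\<^sup>+x. ennreal (f x) \<partial>M) \<le> I"
      unfolding I_def
    proof (intro nn_integral_mono ennreal_leI)
      fix x show "f x \<le> f x powr \<tau>"
        using f[of x] tau_ge_1 powr_mono[of 1 \<tau> "f x"] by auto
    qed
    then have fin: "(\<integral>\<^sup>+x. ennreal (f x) \<partial>M) < \<infinity>" using False by (simp add: less_top order_le_less_trans)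
    let ?H = "\<lambda>i. (\<Union>y\<in>{y. ennreal (a ^ Suc i) \<le> (\<integral>\<^sup>+x\<in>ball y 1. ennreal (f x) \<partial>M)}. ball y (real (Suc i)))"
    let ?E = "\<lambda>i. (\<Union>k<Suc i. {x. ennreal (c2 * a ^ Suc i * sqrt \<rho> ^ (Suc i - k)) < (\<integral>\<^sup>+y\<in>ball x (Suc i). level_part f k y \<partial>M)})"
    have H: "?H i \<in> sets M" for i by (simp add: open_UN)
    have E: "?E i \<in> sets M" for i
      using ball_integral_lower_semicontinuous[OF sets_M borel_measurable_level_part] by (intro sets.finite_UN) auto
    have "emeasure M (\<Union>i. {x. ennreal (c1 * a ^ Suc i) < (\<integral>\<^sup>+y\<in>ball x (Suc i). ennreal (f y) \<partial>M)})
      \<le> emeasure M (\<Union>i. ?H i \<union> ?E i)"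
    proof (rule emeasure_mono)
      show "(\<Union>i. {x. ennreal (c1 * a ^ Suc i) < (\<integral>\<^sup>+y\<in>ball x (Suc i). ennreal (f y) \<partial>M)}) \<subseteq> (\<Union>i. ?H i \<union> ?E i)"
      proof (rule UN_mono, simp, rule subsetI)
        fix i x assume "x \<in> {x. ennreal (c1 * a ^ Suc i) < (\<integral>\<^sup>+y\<in>ball x (Suc i). ennreal (f y) \<partial>M)}"
        then show "x \<in> ?H i \<union> ?E i"
          unfolding mem_Collect_eq c2_def by (intro large_ball_integral_cases f0 fin c1) simp_all
      qed
      show "(\<Union>i. ?H i \<union> ?E i) \<in> sets M"
        by (intro sets.countable_UN image_subsetI sets.Un H E)
    qed
    also have "\<dots> \<le> (\<Sum>i. emeasure M (?H i \<union> ?E i))"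
      by (intro emeasure_subadditive_countably image_subsetI sets.Un H E)
    also have "\<dots> \<le> (\<Sum>i. emeasure M (?H i) + emeasure M (?E i))"
      by (intro suminf_le emeasure_subadditive H E) simp_all
    also have "\<dots> = (\<Sum>i. emeasure M (?H i)) + (\<Sum>i. emeasure M (?E i))"
      by (rule suminf_add[symmetric]) simp_all
    also have "\<dots> \<le> ennreal K\<^sub>h * I + ennreal K\<^sub>l * (I + (\<integral>\<^sup>+x. ennreal (unit_ball_mass f x powr \<tau>) \<partial>M))"
      unfolding K\<^sub>h_def K\<^sub>l_def I_def
      by (intro add_mono sum_neighbourhoods_of_heavy_points sum_level_parts f f0 fin c2) simp_all
    also have "\<dots> \<le> ennreal K\<^sub>h * I + ennreal K\<^sub>l * (I + ennreal K\<^sub>j * I)"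
      unfolding K\<^sub>j_def I_def unit_ball_mass_def
      by (intro add_left_mono mult_left_mono nn_integral_ball_integral_powr_le f0 fin) simp_all
    also have "\<dots> = ennreal K * I"
      using pos by (simp add: K_def ennreal_mult distrib_left distrib_right mult_ac)
    finally show ?thesis by (simp add: I_def)
  qed
qed

end

section \<open>Boundedness of the maximal function\<close>

lemma ennreal_powr_mono: "0 \<le> r \<Longrightarrow> x \<le> y \<Longrightarrow> ennreal_powr x r \<le> ennreal_powr y r"
  by (cases x; cases y) (auto simp: ennreal_powr_def powr_mono2 ennreal_leI top_unique)

lemma ennreal_powr_ennreal: "0 \<le> x \<Longrightarrow> ennreal_powr (ennreal x) r = ennreal (x powr r)"
  by (simp add: ennreal_powr_def)

lemma Lp_norm_finite_exponent:
  assumes "0 < q"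
  shows "Lp_norm M (ennreal q) g = ennreal_powr (\<integral>\<^sup>+x. ennreal_powr (g x) q \<partial>M) (1 / q)"
  using assms by (simp add: Lp_norm_def)

text \<open>If \<open>2 powr k < v \<le> 2 powr (k + 1)\<close>, the term of index \<open>k\<close> suffices; for \<open>v = \<infinity>\<close> the
  terms are unbounded.\<close>

lemma ennreal_powr_le_dyadic_sum:
  assumes q: "1 \<le> q"
  shows "ennreal_powr v q \<le> (\<integral>\<^sup>+k. ennreal (2 powr ((of_int k + 1) * q)) *
    (if ennreal (2 powr of_int k) < v then 1 else 0) \<partial>count_space (UNIV :: int set))" (is "_ \<le> ?S")
proof -
  have point: "ennreal (2 powr ((of_int k + 1) * q)) \<le> ?S" if "ennreal (2 powr of_int k) < v" for k
    using nn_integral_ge_point[of k UNIV "\<lambda>k. ennreal (2 powr ((of_int k + 1) * q)) *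
    (if ennreal (2 powr of_int k) < v then 1 else 0)"] that by simp
  show ?thesis
  proof (cases v)
    case (real w)
    show ?thesis
    proof (cases "w = 0")
      case False
      then have w: "0 < w" using real by simp
      define k where "k = \<lceil>log 2 w\<rceil> - 1"
      have k: "of_int k < log 2 w" "log 2 w \<le> of_int k + 1" unfolding k_def by linarith+
      have "2 powr of_int k < w" using k(1) w by (simp add: less_log_iff)
      have "w \<le> 2 powr (of_int k + 1)" using k(2) w by (simp add: log_le_iff)
      then have "w powr q \<le> (2 powr (of_int k + 1)) powr q" using w q by (intro powr_mono2) auto
      then have "ennreal_powr v q \<le> ennreal (2 powr ((of_int k + 1) * q))"
        using real by (simp add: ennreal_powr_ennreal powr_powr ennreal_leI)
      also have "\<dots> \<le> ?S"
        using \<open>2 powr of_int k < w\<close> real by (intro point) (simp add: ennreal_less_iff)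
      finally show ?thesis .
    qed (simp add: real ennreal_powr_def)
  next
    case top
    have "ennreal (real n) \<le> ?S" for n
    proof -
      have "real n \<le> 2 ^ n" using of_nat_less_two_power[of n, where 'a = real] by simp
      also have "\<dots> = 2 powr (real n * 1)" by (simp add: powr_realpow)
      also have "\<dots> \<le> 2 powr ((of_int (int n) + 1) * q)"
        using q by (intro powr_mono mult_mono) auto
      finally have "ennreal (real n) \<le> ennreal (2 powr ((of_int (int n) + 1) * q))" by (rule ennreal_leI)
      also have "\<dots> \<le> ?S" by (rule point) (simp add: top)
      finally show ?thesis .
    qed
    then have "of_nat n \<le> ?S" for n by (simp only: ennreal_of_nat_eq_real_of_nat)
    then have "\<not> ?S < top" using ennreal_Ex_less_of_nat[of ?S] by (meson leD)
    then show ?thesis by (simp only: not_less top_unique top_greatest)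
  qed
qed

text \<open>The geometric series over the integers \<open>k \<le> N\<close> is read backwards from
  \<open>N = \<lceil>log 2 v\<rceil>\<close>.\<close>

lemma dyadic_geometric_sum_le:
  assumes s: "0 < s" and v: "0 < v"
  shows "(\<integral>\<^sup>+k. ennreal (2 powr (of_int k * s)) * (if 2 powr (of_int k - 1) < v then 1 else 0) \<partial>count_space (UNIV :: int set))
    \<le> ennreal ((2 * v) powr s / (1 - 2 powr - s))"
proof -
  define N where "N = \<lceil>log 2 v\<rceil>"
  have N: "log 2 v \<le> of_int N" "of_int N \<le> log 2 v + 1" unfolding N_def by linarith+
  define r where "r = 2 powr - s"
  have r: "0 < r" "r < 1" using s by (auto simp: r_def intro!: powr_less_one)
  have "(\<integral>\<^sup>+k. ennreal (2 powr (of_int k * s)) * (if 2 powr (of_int k - 1) < v then 1 else 0) \<partial>count_space (UNIV :: int set))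
    \<le> (\<integral>\<^sup>+k. ennreal (2 powr (of_int k * s)) * indicator {..N} k \<partial>count_space (UNIV :: int set))"
  proof (intro nn_integral_mono mult_left_mono)
    fix k :: int
    have "k \<le> N" if "2 powr (of_int k - 1) < v"
    proof -
      have "of_int k - 1 < log 2 v" using that v by (simp add: less_log_iff)
      then show ?thesis using N(1) by linarith
    qed
    then show "(if 2 powr (of_int k - 1) < v then 1 else 0) \<le> (indicator {..N} k :: ennreal)"
      by (auto split: split_indicator)
  qed simp
  also have "\<dots> = (\<integral>\<^sup>+k. ennreal (2 powr (of_int k * s)) \<partial>count_space {..N})"
    by (simp add: nn_integral_count_space_indicator)
  also have "\<dots> = (\<integral>\<^sup>+i. ennreal (2 powr (of_int (N - int i) * s)) \<partial>count_space (UNIV :: nat set))"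
    by (rule nn_integral_bij_count_space[symmetric])
      (rule bij_betw_byWitness[where f' = "\<lambda>k. nat (N - k)"], auto)
  also have "\<dots> = (\<Sum>i. ennreal (2 powr (of_int (N - int i) * s)))"
    by (rule nn_integral_count_space_nat)
  also have "\<dots> \<le> ennreal ((2 * v) powr s / (1 - r))"
  proof (rule suminf_le_if_partial_sums_le)
    fix n
    have eq: "2 powr (of_int (N - int i) * s) = 2 powr (of_int N * s) * r ^ i" for i
    proof -
      have "of_int (N - int i) * s = of_int N * s + real i * (- s)" by (simp add: algebra_simps)
      then have "2 powr (of_int (N - int i) * s) = 2 powr (of_int N * s) * 2 powr (real i * (- s))"
        by (simp only: powr_add)
      also have "2 powr (real i * (- s)) = r ^ i"
        by (simp add: r_def powr_powr mult.commute flip: powr_realpow)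
      finally show ?thesis .
    qed
    have "(\<Sum>i<n. ennreal (2 powr (of_int (N - int i) * s))) = ennreal (2 powr (of_int N * s) * (\<Sum>i<n. r ^ i))"
      unfolding eq using r by (subst sum_ennreal) (simp_all add: sum_distrib_left)
    also have "\<dots> \<le> ennreal ((2 * v) powr s * (1 / (1 - r)))"
    proof (intro ennreal_leI mult_mono)
      have "2 powr of_int N \<le> 2 powr (log 2 v + 1)" using N(2) by (intro powr_mono) auto
      also have "\<dots> = 2 * v" using v by (simp add: powr_add)
      finally have "(2 powr of_int N) powr s \<le> (2 * v) powr s" using s by (intro powr_mono2) auto
      then show "2 powr (of_int N * s) \<le> (2 * v) powr s" by (simp add: powr_powr)
      have "(\<Sum>i<n. r ^ i) = (1 - r ^ n) / (1 - r)" using r by (simp add: sum_gp_strict)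
      also have "\<dots> \<le> 1 / (1 - r)" using r by (intro divide_right_mono) auto
      finally show "(\<Sum>i<n. r ^ i) \<le> 1 / (1 - r)" .
    qed (use r in \<open>auto intro: sum_nonneg\<close>)
    finally show "(\<Sum>i<n. ennreal (2 powr (of_int (N - int i) * s))) \<le> ennreal ((2 * v) powr s / (1 - r))"
      by simp
  qed
  finally show ?thesis by (simp add: r_def)
qed

context pinched_hyperbolic_space
begin

text \<open>The values of \<open>\<bar>f\<bar>\<close> up to \<open>t / 2\<close> account for at most half of an average exceeding \<open>t\<close>.\<close>

lemma less_average_imp_less_ball_integral:
  assumes [measurable]: "f \<in> borel_measurable M" and t: "0 < t" and r: "0 < r"
    and less: "ennreal t < (\<integral>\<^sup>+y\<in>ball x r. ennreal \<bar>f y\<bar> \<partial>M) / emeasure M (ball x r)"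
  shows "emeasure M (ball x r) < (\<integral>\<^sup>+y\<in>ball x r. ennreal (if t / 2 < \<bar>f y\<bar> then 2 * \<bar>f y\<bar> / t else 0) \<partial>M)"
proof (rule ccontr)
  define g where "g y = (if t / 2 < \<bar>f y\<bar> then 2 * \<bar>f y\<bar> / t else 0)" for y
  have [measurable]: "g \<in> borel_measurable M" unfolding g_def[abs_def] by measurable
  define m where "m = emeasure M (ball x r)"
  have m: "m \<noteq> 0" "m < top"
    using emeasure_ball_pos[OF r, of x] emeasure_ball_finite[of x r] by (auto simp: m_def)
  assume "\<not> ?thesis"
  then have le: "(\<integral>\<^sup>+y\<in>ball x r. ennreal (g y) \<partial>M) \<le> m" by (simp add: m_def g_def not_less)
  have "(\<integral>\<^sup>+y\<in>ball x r. ennreal \<bar>f y\<bar> \<partial>M)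
      \<le> (\<integral>\<^sup>+y. ennreal (t / 2) * indicator (ball x r) y + ennreal (t / 2) * (ennreal (g y) * indicator (ball x r) y) \<partial>M)"
  proof (intro nn_integral_mono)
    fix y
    have g0: "0 \<le> g y" using t by (simp add: g_def)
    have "\<bar>f y\<bar> \<le> t / 2 + t / 2 * g y" using t by (simp add: g_def)
    then have "ennreal \<bar>f y\<bar> \<le> ennreal (t / 2 + t / 2 * g y)" by (rule ennreal_leI)
    also have "\<dots> = ennreal (t / 2) + ennreal (t / 2) * ennreal (g y)"
      using t g0 by (subst ennreal_plus, simp, simp, subst ennreal_mult) simp_all
    finally show "ennreal \<bar>f y\<bar> * indicator (ball x r) y \<le> ennreal (t / 2) * indicator (ball x r) y + ennreal (t / 2) * (ennreal (g y) * indicator (ball x r) y)"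
      by (simp split: split_indicator)
  qed
  also have "\<dots> = ennreal (t / 2) * m + ennreal (t / 2) * (\<integral>\<^sup>+y\<in>ball x r. ennreal (g y) \<partial>M)"
    unfolding m_def by (subst nn_integral_add) (simp_all add: nn_integral_cmult nn_integral_cmult_indicator)
  also have "\<dots> \<le> ennreal (t / 2) * m + ennreal (t / 2) * m"
    by (intro add_left_mono mult_left_mono le) simp
  also have "\<dots> = ennreal t * m"
    using t by (simp flip: distrib_right ennreal_plus)
  finally have "(\<integral>\<^sup>+y\<in>ball x r. ennreal \<bar>f y\<bar> \<partial>M) / m \<le> ennreal t * m / m"
    by (rule divide_right_mono_ennreal)
  also have "\<dots> = ennreal t" using m by (simp add: ennreal_mult_divide_eq)
  finally show False using less by (simp add: m_def)
qed

lemma maximal_function_superlevel_estimate: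
  obtains K where "0 < K" and "\<And>f t. f \<in> borel_measurable M \<Longrightarrow> 0 < t \<Longrightarrow>
    emeasure M {x. ennreal t < maximal_function M f x}
      \<le> ennreal (K * t powr - \<tau>) * (\<integral>\<^sup>+x. ennreal (\<bar>f x\<bar> powr \<tau>) * (if t / 2 < \<bar>f x\<bar> then 1 else 0) \<partial>M)"
proof -
  have "0 < c / a" using c_pos one_less_a by simp
  then obtain K0 where K0: "0 < K0" and large: "\<And>g. g \<in> borel_measurable M \<Longrightarrow> (\<And>x. g x = 0 \<or> 1 \<le> g x) \<Longrightarrow>
    emeasure M (\<Union>i. {x. ennreal (c / a * a ^ Suc i) < (\<integral>\<^sup>+y\<in>ball x (Suc i). ennreal (g y) \<partial>M)})
      \<le> ennreal K0 * (\<integral>\<^sup>+x. ennreal (g x powr \<tau>) \<partial>M)"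
    using large_ball_weak_estimate by blast
  show thesis
  proof
    show "0 < (L\<^sup>2 + K0) * 2 powr \<tau>" using L_pos K0 by (simp add: add_pos_pos)
    fix f :: "'a \<Rightarrow> real" and t :: real
    assume [measurable]: "f \<in> borel_measurable M" and t: "0 < t"
    define g where "g y = (if t / 2 < \<bar>f y\<bar> then 2 * \<bar>f y\<bar> / t else 0)" for y
    have [measurable]: "g \<in> borel_measurable M" unfolding g_def[abs_def] by measurable
    have g: "g y = 0 \<or> 1 \<le> g y" for y using t by (simp add: g_def)
    define I where "I = (\<integral>\<^sup>+x. ennreal (g x powr \<tau>) \<partial>M)"
    obtain U where U: "U \<in> sets M"
      "{x. \<exists>r. 0 < r \<and> r \<le> 1 \<and> emeasure M (ball x r) < (\<integral>\<^sup>+y\<in>ball x r. ennreal (g y) \<partial>M)} \<subseteq> U"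
      "emeasure M U \<le> ennreal (L\<^sup>2) * (\<integral>\<^sup>+y. ennreal (g y) \<partial>M)"
      by (rule local_covering_estimate[of "\<lambda>y. ennreal (g y)"]) simp_all
    define E where "E i = {x. ennreal (c / a * a ^ Suc i) < (\<integral>\<^sup>+y\<in>ball x (Suc i). ennreal (g y) \<partial>M)}" for i
    have E: "E i \<in> sets M" for i
      unfolding E_def using ball_integral_lower_semicontinuous[OF sets_M, of "\<lambda>y. ennreal (g y)"] by simp
    then have UE: "(\<Union>i. E i) \<in> sets M" by (intro sets.countable_UN image_subsetI)
    have "{x. ennreal t < maximal_function M f x} \<subseteq> U \<union> (\<Union>i. E i)"
    proof
      fix x assume "x \<in> {x. ennreal t < maximal_function M f x}"
      then obtain r where r: "0 < r" "ennreal t < (\<integral>\<^sup>+y\<in>ball x r. ennreal \<bar>f y\<bar> \<partial>M) / emeasure M (ball x r)"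
        by (auto simp: maximal_function_def less_SUP_iff)
      have less: "emeasure M (ball x r) < (\<integral>\<^sup>+y\<in>ball x r. ennreal (g y) \<partial>M)"
        unfolding g_def by (rule less_average_imp_less_ball_integral[OF _ t r]) simp
      show "x \<in> U \<union> (\<Union>i. E i)"
      proof (cases "r \<le> 1")
        case True
        then show ?thesis using U(2) r(1) less by blast
      next
        case False
        define i where "i = nat \<lceil>r\<rceil> - 1"
        have i: "real i \<le> r" "r \<le> real (Suc i)" using False unfolding i_def by linarith+
        have "c / a * a ^ Suc i = c * a powr real i"
          using one_less_a by (simp add: powr_realpow)
        also have "\<dots> \<le> c * a powr r" using i one_less_a c_pos by (intro mult_left_mono powr_mono) auto
        finally have "ennreal (c / a * a ^ Suc i) \<le> ennreal (c * a powr r)" by (rule ennreal_leI)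
        also have "\<dots> \<le> emeasure M (ball x r)" using False by (intro ball_lower) simp
        also note less
        also have "(\<integral>\<^sup>+y\<in>ball x r. ennreal (g y) \<partial>M) \<le> (\<integral>\<^sup>+y\<in>ball x (Suc i). ennreal (g y) \<partial>M)"
          using i by (intro nn_integral_mono) (auto split: split_indicator)
        finally show ?thesis by (auto simp: E_def)
      qed
    qed
    then have "emeasure M {x. ennreal t < maximal_function M f x} \<le> emeasure M (U \<union> (\<Union>i. E i))"
      using U(1) UE by (intro emeasure_mono) auto
    also have "\<dots> \<le> emeasure M U + emeasure M (\<Union>i. E i)"
      by (rule emeasure_subadditive[OF U(1) UE])
    also have "\<dots> \<le> ennreal (L\<^sup>2) * I + ennreal K0 * I"
    proof (rule add_mono)
      have "(\<integral>\<^sup>+y. ennreal (g y) \<partial>M) \<le> I"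
        unfolding I_def
      proof (intro nn_integral_mono ennreal_leI)
        fix x show "g x \<le> g x powr \<tau>"
          using g[of x] tau_ge_1 powr_mono[of 1 \<tau> "g x"] by auto
      qed
      then show "emeasure M U \<le> ennreal (L\<^sup>2) * I"
        by (intro order_trans[OF U(3)] mult_left_mono) simp_all
      show "emeasure M (\<Union>i. E i) \<le> ennreal K0 * I"
        unfolding E_def I_def by (intro large g) simp
    qed
    also have "\<dots> = ennreal (L\<^sup>2 + K0) * I" using K0 by (simp add: distrib_right)
    also have "I = (\<integral>\<^sup>+x. ennreal (2 powr \<tau> * t powr - \<tau>) * (ennreal (\<bar>f x\<bar> powr \<tau>) * (if t / 2 < \<bar>f x\<bar> then 1 else 0)) \<partial>M)"
      unfolding I_def using t
      by (intro nn_integral_cong) (simp add: g_def powr_divide powr_mult powr_minus_divide flip: ennreal_mult)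
    also have "\<dots> = ennreal (2 powr \<tau> * t powr - \<tau>) * (\<integral>\<^sup>+x. ennreal (\<bar>f x\<bar> powr \<tau>) * (if t / 2 < \<bar>f x\<bar> then 1 else 0) \<partial>M)"
      by (rule nn_integral_cmult) measurable
    also have "ennreal (L\<^sup>2 + K0) * \<dots> = ennreal ((L\<^sup>2 + K0) * 2 powr \<tau> * t powr - \<tau>) * (\<integral>\<^sup>+x. ennreal (\<bar>f x\<bar> powr \<tau>) * (if t / 2 < \<bar>f x\<bar> then 1 else 0) \<partial>M)"
      using K0 by (simp add: ennreal_mult mult.assoc)
    finally show "emeasure M {x. ennreal t < maximal_function M f x}
      \<le> ennreal ((L\<^sup>2 + K0) * 2 powr \<tau> * t powr - \<tau>) * (\<integral>\<^sup>+x. ennreal (\<bar>f x\<bar> powr \<tau>) * (if t / 2 < \<bar>f x\<bar> then 1 else 0) \<partial>M)" .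
  qed
qed

text \<open>All mapping properties are consequences of the preceding estimate, except the trivial one on
  \<open>L\<^sup>\<infinity>\<close>.\<close>

lemma maximal_function_weak_type: "weak_type M \<tau> (maximal_function M)"
proof -
  obtain K where K: "0 < K" and est: "\<And>f t. f \<in> borel_measurable M \<Longrightarrow> 0 < t \<Longrightarrow>
    emeasure M {x. ennreal t < maximal_function M f x}
      \<le> ennreal (K * t powr - \<tau>) * (\<integral>\<^sup>+x. ennreal (\<bar>f x\<bar> powr \<tau>) * (if t / 2 < \<bar>f x\<bar> then 1 else 0) \<partial>M)"
    using maximal_function_superlevel_estimate by blast
  show ?thesis
    unfolding weak_type_def
  proof (intro exI[of _ K] ballI conjI allI impI)
    fix f assume "f \<in> Lp_space M (ennreal \<tau>)"
    then have f: "f \<in> borel_measurable M" and fin: "Lp_norm M (ennreal \<tau>) (\<lambda>x. ennreal \<bar>f x\<bar>) < top"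
      by (auto simp: Lp_space_def)
    show "maximal_function M f \<in> borel_measurable M"
      by (rule borel_measurable_maximal_function[OF sets_M f])
    fix t :: real assume t: "0 < t"
    define I where "I = (\<integral>\<^sup>+x. ennreal (\<bar>f x\<bar> powr \<tau>) \<partial>M)"
    have norm: "Lp_norm M (ennreal \<tau>) (\<lambda>x. ennreal \<bar>f x\<bar>) = ennreal_powr I (1 / \<tau>)"
      using tau_ge_1 by (simp add: Lp_norm_finite_exponent ennreal_powr_ennreal I_def)
    then have "I \<noteq> top" using fin by (auto simp: ennreal_powr_def)
    then have I: "ennreal_powr (ennreal_powr I (1 / \<tau>)) \<tau> = I"
      using tau_ge_1 by (cases I) (auto simp: ennreal_powr_def powr_powr)
    have "(\<integral>\<^sup>+x. ennreal (\<bar>f x\<bar> powr \<tau>) * (if t / 2 < \<bar>f x\<bar> then 1 else 0) \<partial>M) \<le> I"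
      unfolding I_def by (intro nn_integral_mono) simp
    then show "emeasure M {x \<in> space M. ennreal t < maximal_function M f x}
        \<le> ennreal (K * t powr - \<tau>) * ennreal_powr (Lp_norm M (ennreal \<tau>) (\<lambda>x. ennreal \<bar>f x\<bar>)) \<tau>"
      unfolding norm I using order_trans[OF est[OF f t] mult_left_mono] by simp
  qed
qed

lemma maximal_function_bounded_L_infinity: "bounded_on_Lp M top (maximal_function M)"
  unfolding bounded_on_Lp_def
proof (intro exI[of _ 1] ballI conjI)
  fix f assume "f \<in> Lp_space M top"
  then have f [measurable]: "f \<in> borel_measurable M" by (simp add: Lp_space_def)
  show meas: "maximal_function M f \<in> borel_measurable M"
    by (rule borel_measurable_maximal_function[OF sets_M f])
  define S where "S = esssup M (\<lambda>x. ennreal \<bar>f x\<bar>)"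
  have AE: "AE x in M. ennreal \<bar>f x\<bar> \<le> S" unfolding S_def by (rule esssup_AE)
  have "maximal_function M f x \<le> S" for x
    unfolding maximal_function_def
  proof (rule SUP_least)
    fix r :: real assume "r \<in> {0<..}"
    then have m: "emeasure M (ball x r) \<noteq> 0" "emeasure M (ball x r) < top"
      using emeasure_ball_pos[of r x] emeasure_ball_finite[of x r] by auto
    have "(\<integral>\<^sup>+y\<in>ball x r. ennreal \<bar>f y\<bar> \<partial>M) \<le> (\<integral>\<^sup>+y. S * indicator (ball x r) y \<partial>M)"
      using AE by (intro nn_integral_mono_AE) (auto split: split_indicator)
    also have "\<dots> = S * emeasure M (ball x r)" by (rule nn_integral_cmult_indicator) simp
    finally have "(\<integral>\<^sup>+y\<in>ball x r. ennreal \<bar>f y\<bar> \<partial>M) / emeasure M (ball x r) \<le> S * emeasure M (ball x r) / emeasure M (ball x r)"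
      by (rule divide_right_mono_ennreal)
    also have "\<dots> = S" using m by (simp add: ennreal_mult_divide_eq)
    finally show "(\<integral>\<^sup>+y\<in>ball x r. ennreal \<bar>f y\<bar> \<partial>M) / emeasure M (ball x r) \<le> S" .
  qed
  then show "Lp_norm M top (maximal_function M f) \<le> ennreal 1 * Lp_norm M top (\<lambda>x. ennreal \<bar>f x\<bar>)"
    using esssup_I[OF meas, of S] by (simp add: Lp_norm_def S_def)
qed

text \<open>The Marcinkiewicz argument with dyadic levels \<open>t = 2 powr k\<close>.\<close>

lemma nn_integral_maximal_function_powr_le:
  assumes q: "\<tau> < q"
  obtains K where "0 < K" and "\<And>f. f \<in> borel_measurable M \<Longrightarrow>
    (\<integral>\<^sup>+x. ennreal_powr (maximal_function M f x) q \<partial>M) \<le> ennreal K * (\<integral>\<^sup>+x. ennreal (\<bar>f x\<bar> powr q) \<partial>M)"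
proof -
  obtain K where K: "0 < K" and est: "\<And>f t. f \<in> borel_measurable M \<Longrightarrow> 0 < t \<Longrightarrow>
    emeasure M {x. ennreal t < maximal_function M f x}
      \<le> ennreal (K * t powr - \<tau>) * (\<integral>\<^sup>+x. ennreal (\<bar>f x\<bar> powr \<tau>) * (if t / 2 < \<bar>f x\<bar> then 1 else 0) \<partial>M)"
    using maximal_function_superlevel_estimate by blast
  define s where "s = q - \<tau>"
  have s: "0 < s" using q by (simp add: s_def)
  have s1: "2 powr - s < 1" using s by (intro powr_less_one) auto
  have q1: "1 \<le> q" using q tau_ge_1 by simp
  define B where "B = K * 2 powr q * (2 powr s / (1 - 2 powr - s))"
  show thesis
  proof
    show "0 < B" using K s1 by (simp add: B_def)
    fix f :: "'a \<Rightarrow> real" assume f [measurable]: "f \<in> borel_measurable M"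
    have [measurable]: "maximal_function M f \<in> borel_measurable M"
      by (rule borel_measurable_maximal_function[OF sets_M f])
    define ind where "ind k x = (if 2 powr (of_int k - 1) < \<bar>f x\<bar> then 1 else 0 :: ennreal)" for k :: int and x
    have [measurable]: "ind k \<in> borel_measurable M" for k unfolding ind_def[abs_def] by measurable
    have "(\<integral>\<^sup>+x. ennreal_powr (maximal_function M f x) q \<partial>M)
       \<le> (\<integral>\<^sup>+x. \<integral>\<^sup>+k. ennreal (2 powr ((of_int k + 1) * q)) *
        (if ennreal (2 powr of_int k) < maximal_function M f x then 1 else 0) \<partial>count_space (UNIV :: int set) \<partial>M)"
      by (intro nn_integral_mono ennreal_powr_le_dyadic_sum q1)
    also have "\<dots> = (\<integral>\<^sup>+k. \<integral>\<^sup>+x. ennreal (2 powr ((of_int k + 1) * q)) *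
        (if ennreal (2 powr of_int k) < maximal_function M f x then 1 else 0) \<partial>M \<partial>count_space (UNIV :: int set))"
      by (rule nn_integral_count_space_nn_integral) simp_all
    also have "\<dots> \<le> (\<integral>\<^sup>+k. \<integral>\<^sup>+x. ennreal (K * 2 powr q * 2 powr (of_int k * s)) * (ennreal (\<bar>f x\<bar> powr \<tau>) * ind k x) \<partial>M \<partial>count_space (UNIV :: int set))"
    proof (rule nn_integral_mono)
      fix k :: int
      have "(\<integral>\<^sup>+x. ennreal (2 powr ((of_int k + 1) * q)) * (if ennreal (2 powr of_int k) < maximal_function M f x then 1 else 0) \<partial>M)
        = (\<integral>\<^sup>+x. ennreal (2 powr ((of_int k + 1) * q)) * indicator {x \<in> space M. ennreal (2 powr of_int k) < maximal_function M f x} x \<partial>M)"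
        by (intro nn_integral_cong) (simp split: split_indicator)
      also have "\<dots> = ennreal (2 powr ((of_int k + 1) * q)) * emeasure M {x. ennreal (2 powr of_int k) < maximal_function M f x}"
        by (subst nn_integral_cmult_indicator) simp_all
      also have "\<dots> \<le> ennreal (2 powr ((of_int k + 1) * q)) * (ennreal (K * (2 powr of_int k) powr - \<tau>) *
          (\<integral>\<^sup>+x. ennreal (\<bar>f x\<bar> powr \<tau>) * (if 2 powr of_int k / 2 < \<bar>f x\<bar> then 1 else 0) \<partial>M))"
        by (intro mult_left_mono est f) simp_all
      also have "\<dots> = ennreal (2 powr ((of_int k + 1) * q) * (K * (2 powr of_int k) powr - \<tau>)) * (\<integral>\<^sup>+x. ennreal (\<bar>f x\<bar> powr \<tau>) * ind k x \<partial>M)"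
        using K by (simp add: ennreal_mult mult.assoc ind_def powr_diff)
      also have "2 powr ((of_int k + 1) * q) * (K * (2 powr of_int k) powr - \<tau>) = K * (2 powr ((of_int k + 1) * q) * 2 powr (of_int k * - \<tau>))"
        by (simp only: powr_powr mult_ac)
      also have "2 powr ((of_int k + 1) * q) * 2 powr (of_int k * - \<tau>) = 2 powr (q + of_int k * s)"
        unfolding powr_add[symmetric] by (rule arg_cong[of _ _ "(powr) 2"]) (simp add: s_def algebra_simps)
      also have "K * 2 powr (q + of_int k * s) = K * 2 powr q * 2 powr (of_int k * s)"
        by (simp only: powr_add mult.assoc)
      also have "ennreal (K * 2 powr q * 2 powr (of_int k * s)) * (\<integral>\<^sup>+x. ennreal (\<bar>f x\<bar> powr \<tau>) * ind k x \<partial>M)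
         = (\<integral>\<^sup>+x. ennreal (K * 2 powr q * 2 powr (of_int k * s)) * (ennreal (\<bar>f x\<bar> powr \<tau>) * ind k x) \<partial>M)"
        by (rule nn_integral_cmult[symmetric]) measurable
      finally show "(\<integral>\<^sup>+x. ennreal (2 powr ((of_int k + 1) * q)) * (if ennreal (2 powr of_int k) < maximal_function M f x then 1 else 0) \<partial>M) \<le> \<dots>" .
    qed
    also have "\<dots> = (\<integral>\<^sup>+x. \<integral>\<^sup>+k. ennreal (K * 2 powr q * 2 powr (of_int k * s)) * (ennreal (\<bar>f x\<bar> powr \<tau>) * ind k x) \<partial>count_space (UNIV :: int set) \<partial>M)"
      by (rule nn_integral_count_space_nn_integral[symmetric]) simp_all
    also have "\<dots> \<le> (\<integral>\<^sup>+x. ennreal B * ennreal (\<bar>f x\<bar> powr q) \<partial>M)"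
    proof (intro nn_integral_mono)
      fix x
      define v where "v = \<bar>f x\<bar>"
      have "(\<integral>\<^sup>+k. ennreal (K * 2 powr q * 2 powr (of_int k * s)) * (ennreal (v powr \<tau>) * ind k x) \<partial>count_space UNIV)
        = (\<integral>\<^sup>+k. ennreal (K * 2 powr q * v powr \<tau>) * (ennreal (2 powr (of_int k * s)) * ind k x) \<partial>count_space UNIV)"
        using K by (intro nn_integral_cong) (simp add: ennreal_mult mult_ac)
      also have "\<dots> = ennreal (K * 2 powr q * v powr \<tau>) * (\<integral>\<^sup>+k. ennreal (2 powr (of_int k * s)) * ind k x \<partial>count_space UNIV)"
        by (rule nn_integral_cmult) simp
      also have "\<dots> \<le> ennreal B * ennreal (v powr q)"
      proof (cases "v = 0")
        case False
        then have v: "0 < v" by (simp add: v_def)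
        have "(\<integral>\<^sup>+k. ennreal (2 powr (of_int k * s)) * ind k x \<partial>count_space UNIV) \<le> ennreal ((2 * v) powr s / (1 - 2 powr - s))"
          unfolding ind_def v_def[symmetric] by (rule dyadic_geometric_sum_le[OF s v])
        then have "ennreal (K * 2 powr q * v powr \<tau>) * (\<integral>\<^sup>+k. ennreal (2 powr (of_int k * s)) * ind k x \<partial>count_space UNIV)
          \<le> ennreal (K * 2 powr q * v powr \<tau>) * ennreal ((2 * v) powr s / (1 - 2 powr - s))"
          by (rule mult_left_mono) simp
        also have "\<dots> = ennreal (K * 2 powr q * v powr \<tau> * ((2 * v) powr s / (1 - 2 powr - s)))"
          using K s1 by (intro ennreal_mult[symmetric]) simp_all
        also have "K * 2 powr q * v powr \<tau> * ((2 * v) powr s / (1 - 2 powr - s)) = B * (v powr \<tau> * v powr s)"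
          using v by (simp add: B_def powr_mult)
        also have "v powr \<tau> * v powr s = v powr q" by (simp add: s_def flip: powr_add)
        also have "ennreal (B * v powr q) = ennreal B * ennreal (v powr q)"
          using \<open>0 < B\<close> by (intro ennreal_mult) simp_all
        finally show ?thesis .
      qed simp
      finally show "(\<integral>\<^sup>+k. ennreal (K * 2 powr q * 2 powr (of_int k * s)) * (ennreal (\<bar>f x\<bar> powr \<tau>) * ind k x) \<partial>count_space UNIV)
          \<le> ennreal B * ennreal (\<bar>f x\<bar> powr q)"
        by (simp add: v_def)
    qed
    also have "\<dots> = ennreal B * (\<integral>\<^sup>+x. ennreal (\<bar>f x\<bar> powr q) \<partial>M)"
      by (rule nn_integral_cmult) measurable
    finally show "(\<integral>\<^sup>+x. ennreal_powr (maximal_function M f x) q \<partial>M) \<le> ennreal B * (\<integral>\<^sup>+x. ennreal (\<bar>f x\<bar> powr q) \<partial>M)" .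
  qed
qed

lemma maximal_function_bounded_Lp:
  assumes q: "\<tau> < q"
  shows "bounded_on_Lp M (ennreal q) (maximal_function M)"
proof -
  obtain K where K: "0 < K" and est: "\<And>f. f \<in> borel_measurable M \<Longrightarrow>
    (\<integral>\<^sup>+x. ennreal_powr (maximal_function M f x) q \<partial>M) \<le> ennreal K * (\<integral>\<^sup>+x. ennreal (\<bar>f x\<bar> powr q) \<partial>M)"
    using nn_integral_maximal_function_powr_le[OF q] by blast
  have q0: "0 < q" using q tau_ge_1 by simp
  show ?thesis
    unfolding bounded_on_Lp_def
  proof (intro exI[of _ "K powr (1 / q)"] ballI conjI)
    fix f assume "f \<in> Lp_space M (ennreal q)"
    then have f: "f \<in> borel_measurable M" and fin: "Lp_norm M (ennreal q) (\<lambda>x. ennreal \<bar>f x\<bar>) < top"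
      by (auto simp: Lp_space_def)
    show "maximal_function M f \<in> borel_measurable M"
      by (rule borel_measurable_maximal_function[OF sets_M f])
    define I where "I = (\<integral>\<^sup>+x. ennreal (\<bar>f x\<bar> powr q) \<partial>M)"
    have norm: "Lp_norm M (ennreal q) (\<lambda>x. ennreal \<bar>f x\<bar>) = ennreal_powr I (1 / q)"
      using q0 by (simp add: Lp_norm_finite_exponent ennreal_powr_ennreal I_def)
    then obtain J where J: "I = ennreal J" "0 \<le> J" using fin by (cases I) (auto simp: ennreal_powr_def)
    have "Lp_norm M (ennreal q) (maximal_function M f) \<le> ennreal_powr (ennreal K * I) (1 / q)"
      using q0 est[OF f] by (simp add: Lp_norm_finite_exponent ennreal_powr_mono I_def)
    also have "\<dots> = ennreal_powr (ennreal (K * J)) (1 / q)"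
      using K J by (simp add: ennreal_mult)
    also have "\<dots> = ennreal (K powr (1 / q)) * ennreal_powr I (1 / q)"
      using K J by (subst J(1), subst (1 2) ennreal_powr_ennreal) (simp_all add: powr_mult ennreal_mult)
    finally show "Lp_norm M (ennreal q) (maximal_function M f)
        \<le> ennreal (K powr (1 / q)) * Lp_norm M (ennreal q) (\<lambda>x. ennreal \<bar>f x\<bar>)"
      by (simp add: norm)
  qed
qed

end

lemma pinched_hyperbolic_space_if_class_X:
  fixes \<mu> :: "'a::metric_space measure"
  assumes "1 < a" "a \<le> b" "b < a\<^sup>2" "0 \<le> \<delta>" "\<tau> = log a b" and X: "\<mu> \<in> class_X \<delta> a b"
  obtains c C L where "pinched_hyperbolic_space \<mu> a b \<tau> \<delta> c C L"
proof -
  from X have sets: "sets \<mu> = sets borel" and hyp: "Gromov_hyperbolic \<delta> (UNIV :: 'a set)"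
    and intr: "strictly_intrinsic (UNIV :: 'a set)" and dbl: "locally_doubling \<mu>"
    and growth: "pinched_exponential_growth a b \<mu>"
    by (auto simp: class_X_def)
  obtain c C where "0 < c" "0 < C" and cC: "\<And>x r. 1 \<le> r \<Longrightarrow> ennreal (c * a powr r) \<le> emeasure \<mu> (ball x r)"
      "\<And>x r. 1 \<le> r \<Longrightarrow> emeasure \<mu> (ball x r) \<le> ennreal (C * b powr r)"
    using growth unfolding pinched_exponential_growth_def by blast
  obtain L :: real where L: "\<And>x r. 0 < r \<Longrightarrow> r \<le> 2 \<Longrightarrow> emeasure \<mu> (ball x (2 * r)) \<le> ennreal L * emeasure \<mu> (ball x r)"
    using dbl unfolding locally_doubling_def by (metis zero_less_numeral)
  have "pinched_hyperbolic_space \<mu> a b \<tau> \<delta> c C (max 1 L)"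
  proof
    fix x and r :: real assume "0 < r" "r \<le> 2"
    then have "emeasure \<mu> (ball x (2 * r)) \<le> ennreal L * emeasure \<mu> (ball x r)" by (rule L)
    also have "\<dots> \<le> ennreal (max 1 L) * emeasure \<mu> (ball x r)"
      by (intro mult_right_mono ennreal_leI) auto
    finally show "emeasure \<mu> (ball x (2 * r)) \<le> ennreal (max 1 L) * emeasure \<mu> (ball x r)" .
  qed (use assms sets hyp intr cC \<open>0 < c\<close> \<open>0 < C\<close> in auto)
  then show thesis by (rule that)
qed

theorem theorem1p1:
  fixes a b \<delta> \<tau> :: real and \<mu> :: "'a::metric_space measure"
  assumes "1 < a" and "a \<le> b" and "b < a\<^sup>2" and "0 \<le> \<delta>"
    and "\<tau> = log a b"
    and "\<mu> \<in> class_X \<delta> a b"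
  shows "(\<forall>p::ennreal. ennreal \<tau> < p \<longrightarrow> bounded_on_Lp \<mu> p (maximal_function \<mu>))
         \<and> weak_type \<mu> \<tau> (maximal_function \<mu>)"
proof -
  obtain c C L where "pinched_hyperbolic_space \<mu> a b \<tau> \<delta> c C L"
    using pinched_hyperbolic_space_if_class_X[OF assms] .
  then interpret pinched_hyperbolic_space \<mu> a b \<tau> \<delta> c C L .
  have "bounded_on_Lp \<mu> p (maximal_function \<mu>)" if p: "ennreal \<tau> < p" for p
  proof (cases p)
    case (real q)
    then have "\<tau> < q" using p tau_ge_1 by (simp add: ennreal_less_iff)
    then show ?thesis using maximal_function_bounded_Lp real by simp
  next
    case top
    then show ?thesis using maximal_function_bounded_L_infinity by simp
  qed
  then show ?thesis using maximal_function_weak_type by blast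
qed

end
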